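(* Let $N$ be a (not necessarily abelian) group of odd size, let $\varphi:\mathbb{Z}_2\to\mathrm{Aut}(N)$ be a group homomorphism, and let $G=N\rtimes_\varphi\mathbb{Z}_2$. Then, for every positive integer $k\equiv 8\pmod{10}$, every subset of type $(k/2,k/2)$ of $G\setminus\{(0,0)\}$ admits an alternating parity $4$-weak sequencing.
   Context: Groups are written additively, even when non-abelian. The group $N\rtimes_\varphi\mathbb{Z}_2$ has elements $(x,a)$ with $x\in N$, $a\in\mathbb{Z}_2$, and operation $(x_1,a_1)+(x_2,a_2)=(x_1+\varphi(a_1)(x_2),\,a_1+a_2)$; its identity is $(0,0)$. Elements $(x,0)$ are called even and elements $(x,1)$ odd. A finite subset $S$ has type $(\lambda_0,\lambda_1)$ if it contains exactly $\lambda_0$ even elements and $\lambda_1$ odd elements. A $t$-weak sequencing of a set $S$ of size $k$ is an ordering $(y_1,\ldots,y_k)$ of its elements such that the partial sums $s_0=0$ and $s_i=y_1+y_2+\cdots+y_i$ ($1\le i\le k$, sums taken in this order) satisfy $s_i\neq s_j$ for all $0\le i,j\le k$ with $1\le |i-j|\le t$. It is alternating parity if even and odd elements alternate in the ordering, i.e. any two consecutive elements have different parity. *)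

theory Defs
  imports "HOL-Algebra.Bij" "HOL-Algebra.Elementary_Groups" "HOL-Number_Theory.Cong"
begin

text \<open>HOL-Algebra writes groups multiplicatively: \<open>\<otimes>\<close> and \<open>\<one>\<close> below are the
  addition and the zero of the (possibly non-abelian) groups of the additively written source.\<close>

definition semidirect_product ::
    "('a, 'c) monoid_scheme \<Rightarrow> ('b, 'd) monoid_scheme \<Rightarrow> ('b \<Rightarrow> 'a \<Rightarrow> 'a) \<Rightarrow> ('a \<times> 'b) monoid"
  where "semidirect_product N H \<phi> =
    \<lparr>carrier = carrier N \<times> carrier H,
     monoid.mult = \<lambda>(x\<^sub>1, a\<^sub>1) (x\<^sub>2, a\<^sub>2). (x\<^sub>1 \<otimes>\<^bsub>N\<^esub> \<phi> a\<^sub>1 x\<^sub>2, a\<^sub>1 \<otimes>\<^bsub>H\<^esub> a\<^sub>2),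
     monoid.one = (\<one>\<^bsub>N\<^esub>, \<one>\<^bsub>H\<^esub>)\<rparr>"

lemma group_semidirect_product:
  assumes N: "group N" and H: "group H" and \<phi>: "\<phi> \<in> hom H (AutoGroup N)"
  shows "group (semidirect_product N H \<phi>)"
proof -
  interpret N: group N by (fact N)
  interpret H: group H by (fact H)
  interpret \<phi>: group_hom H "AutoGroup N" \<phi>
    using H N.AutoGroup \<phi> by (simp add: group_hom_def group_hom_axioms_def)
  have auto: "\<phi> a \<in> auto N" if "a \<in> carrier H" for a
    using \<phi>.hom_closed[OF that] by (simp add: AutoGroup_def)
  have closed: "\<phi> a x \<in> carrier N" if "a \<in> carrier H" "x \<in> carrier N" for a x
    using auto[OF that(1)] that(2) by (auto simp: auto_def hom_def)
  have add: "\<phi> a (x \<otimes>\<^bsub>N\<^esub> y) = \<phi> a x \<otimes>\<^bsub>N\<^esub> \<phi> a y"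
    if "a \<in> carrier H" "x \<in> carrier N" "y \<in> carrier N" for a x y
    using auto[OF that(1)] that(2,3) by (auto simp: auto_def hom_def)
  have comp: "\<phi> (a \<otimes>\<^bsub>H\<^esub> b) x = \<phi> a (\<phi> b x)"
    if "a \<in> carrier H" "b \<in> carrier H" "x \<in> carrier N" for a b x
    using \<phi>.hom_mult[OF that(1,2)] auto[OF that(1)] auto[OF that(2)] that(3)
    by (simp add: AutoGroup_def BijGroup_def auto_def compose_eq)
  have one: "\<phi> \<one>\<^bsub>H\<^esub> x = x" if "x \<in> carrier N" for x
    using \<phi>.hom_one that by (simp add: AutoGroup_def BijGroup_def)
  show ?thesis
  proof (rule groupI)
    fix p assume "p \<in> carrier (semidirect_product N H \<phi>)"
    then obtain x a where p: "p = (x, a)" and x: "x \<in> carrier N" and a: "a \<in> carrier H"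
      by (auto simp: semidirect_product_def)
    let ?q = "(\<phi> (inv\<^bsub>H\<^esub> a) (inv\<^bsub>N\<^esub> x), inv\<^bsub>H\<^esub> a)"
    have "\<phi> (inv\<^bsub>H\<^esub> a) (inv\<^bsub>N\<^esub> x) \<otimes>\<^bsub>N\<^esub> \<phi> (inv\<^bsub>H\<^esub> a) x = \<phi> (inv\<^bsub>H\<^esub> a) \<one>\<^bsub>N\<^esub>"
      using x a by (subst add [symmetric]) (simp_all del: \<phi>.hom_inv)
    also have "\<dots> = \<one>\<^bsub>N\<^esub>"
      using auto[of "inv\<^bsub>H\<^esub> a"] a N hom_one[of "\<phi> (inv\<^bsub>H\<^esub> a)" N N] by (simp add: auto_def del: \<phi>.hom_inv)
    finally show "\<exists>q\<in>carrier (semidirect_product N H \<phi>).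
        q \<otimes>\<^bsub>semidirect_product N H \<phi>\<^esub> p = \<one>\<^bsub>semidirect_product N H \<phi>\<^esub>"
      using p x a closed by (intro bexI[of _ ?q]) (auto simp: semidirect_product_def simp del: \<phi>.hom_inv)
  qed (auto simp: semidirect_product_def closed add comp one N.m_assoc H.m_assoc
      simp del: \<phi>.hom_mult \<phi>.hom_one)
qed

text \<open>\<open>integer_mod_group 2\<close> has carrier \<open>{0, 1}\<close>.\<close>

abbreviation semidirect_Z2 ::
    "('a, 'c) monoid_scheme \<Rightarrow> (int \<Rightarrow> 'a \<Rightarrow> 'a) \<Rightarrow> ('a \<times> int) monoid"
  where "semidirect_Z2 N \<phi> \<equiv> semidirect_product N (integer_mod_group 2) \<phi>"

definition even_elt :: "'a \<times> int \<Rightarrow> bool"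
  where "even_elt g \<longleftrightarrow> snd g = 0"

definition odd_elt :: "'a \<times> int \<Rightarrow> bool"
  where "odd_elt g \<longleftrightarrow> snd g = 1"

definition has_type :: "('a \<times> int) set \<Rightarrow> nat \<Rightarrow> nat \<Rightarrow> bool"
  where "has_type S l\<^sub>0 l\<^sub>1 \<longleftrightarrow>
    finite S \<and> card {g \<in> S. even_elt g} = l\<^sub>0 \<and> card {g \<in> S. odd_elt g} = l\<^sub>1"

definition partial_sum :: "('g, 'c) monoid_scheme \<Rightarrow> 'g list \<Rightarrow> nat \<Rightarrow> 'g"
  where "partial_sum G ys i = foldl (\<otimes>\<^bsub>G\<^esub>) \<one>\<^bsub>G\<^esub> (take i ys)"

definition weak_sequencing ::
    "('g, 'c) monoid_scheme \<Rightarrow> nat \<Rightarrow> 'g set \<Rightarrow> 'g list \<Rightarrow> bool"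
  where "weak_sequencing G t S ys \<longleftrightarrow>
    distinct ys \<and> set ys = S \<and>
    (\<forall>i \<le> length ys. \<forall>j \<le> length ys.
       1 \<le> \<bar>int i - int j\<bar> \<and> \<bar>int i - int j\<bar> \<le> int t \<longrightarrow>
       partial_sum G ys i \<noteq> partial_sum G ys j)"

definition alternating_parity :: "('a \<times> int) list \<Rightarrow> bool"
  where "alternating_parity ys \<longleftrightarrow>
    (\<forall>i. Suc i < length ys \<longrightarrow>
       even_elt (ys ! i) \<and> odd_elt (ys ! Suc i) \<or> odd_elt (ys ! i) \<and> even_elt (ys ! Suc i))"

end

theory Submission
  imports Defs "HOL-Algebra.Multiplicative_Group"
begin

text \<open>
  Write \<open>T u a v\<close> for \<open>u \<otimes> a \<otimes> v = \<one>\<close> and \<open>Q u a v b\<close> for \<open>u \<otimes> a \<otimes> v \<otimes> b = \<one>\<close>. By parity, an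
  alternating ordering is a \<open>4\<close>-weak sequencing iff no three consecutive elements odd, even, odd
  satisfy \<open>T\<close> and no four consecutive elements have product \<open>\<one>\<close>; up to a cyclic rotation the latter
  is again \<open>Q\<close>.

  If there are \<open>n \<ge> 9\<close> elements of each parity, a greedy extension to the right works until three odd
  elements are left. Before that, all even elements that would obstruct a later extension to the
  left by an even element and one reserved odd element \<open>r\<close> are used up. With five even and three
  odd elements left (besides \<open>r\<close>) a careful choice allows three more greedy steps, after which one
  of the two remaining even elements fits on the right and the other one, followed by \<open>r\<close>, on the left.

  For \<open>n = 4\<close> put \<open>C = A \<union> {\<one>}\<close>, where \<open>A\<close> is the set of even elements and \<open>B\<close> the set of odd ones. If
  \<open>(u \<otimes> a \<otimes> v)\<^sup>-\<^sup>1 \<notin> C\<close> for some \<open>u \<noteq> v\<close> in \<open>B\<close> and \<open>a \<in> A\<close>, then an ordering exists already because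
  \<open>T\<close> and \<open>Q\<close> determine each argument from the others, a finite propositional problem. Otherwise each
  map \<open>x \<mapsto> (u \<otimes> x \<otimes> v)\<^sup>-\<^sup>1\<close> permutes \<open>A\<close> or \<open>C\<close>, and comparing two such maps shows that an even
  element permutes a set of size \<open>4\<close> or \<open>5\<close> by translation. As even elements have odd order, \<open>C\<close> is a
  subgroup of order \<open>5\<close> normalised by \<open>B\<close>, and \<open>B\<close> lies in one coset of it, where explicit orderings
  exist.
\<close>

section \<open>Closing elements and greedy steps\<close>

context group
begin

text \<open>The fourth factor that completes \<open>u\<close>, \<open>x\<close>, \<open>v\<close> to
  a product \<open>\<one>\<close>. The arguments of equal parity come first, so that
  \<open>closer u v\<close> is a map on elements of the other parity.\<close>

definition closer :: "'a \<Rightarrow> 'a \<Rightarrow> 'a \<Rightarrow> 'a"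
  where "closer u v x = inv (u \<otimes> x \<otimes> v)"

lemma closer_closed [simp]:
  "u \<in> carrier G \<Longrightarrow> v \<in> carrier G \<Longrightarrow> x \<in> carrier G \<Longrightarrow> closer u v x \<in> carrier G"
  by (simp add: closer_def)

lemma closer_iff:
  assumes "u \<in> carrier G" "v \<in> carrier G" "x \<in> carrier G" "y \<in> carrier G"
  shows "u \<otimes> x \<otimes> v \<otimes> y = \<one> \<longleftrightarrow> y = closer u v x"
  using assms inv_equality inv_inv unfolding closer_def by (metis m_closed r_inv)

lemma closer_eq_iff:
  assumes "u \<in> carrier G" "v \<in> carrier G" "x \<in> carrier G" "y \<in> carrier G"
  shows "closer u v x = closer u v y \<longleftrightarrow> x = y"
  using assms by (simp add: closer_def) (metis inv_inv m_closed Units_eq Units_l_cancel right_cancel)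

lemma closer_left_eq_iff:
  assumes "u \<in> carrier G" "v \<in> carrier G" "x \<in> carrier G" "w \<in> carrier G"
  shows "closer u v x = closer w v x \<longleftrightarrow> u = w"
  using assms by (simp add: closer_def) (metis inv_inv m_closed right_cancel)

lemma closer_right_eq_iff:
  assumes "u \<in> carrier G" "v \<in> carrier G" "x \<in> carrier G" "w \<in> carrier G"
  shows "closer u v x = closer u w x \<longleftrightarrow> v = w"
  using assms by (simp add: closer_def) (metis inv_inv m_closed Units_eq Units_l_cancel)

lemma closer_closer:
  assumes "u \<in> carrier G" "v \<in> carrier G" "x \<in> carrier G"
  shows "closer v u (closer u v x) = x"
  using assms by (simp add: closer_def inv_mult_group m_assoc)

text \<open>
  Appending an even \<open>x\<close> and an odd \<open>y\<close> after \<open>p, a, b\<close> (odd, even, odd) creates a window of length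
  \<open>3\<close> or \<open>4\<close> with product \<open>\<one>\<close> iff \<open>x \<in> blocked p a b y\<close>.
\<close>

definition blocked :: "'a \<Rightarrow> 'a \<Rightarrow> 'a \<Rightarrow> 'a \<Rightarrow> 'a set"
  where "blocked p a b y = {closer p b a, closer y b a, closer y b \<one>}"

lemma card_blocked_le: "card (blocked p a b y) \<le> 3"
  using card_length[of "[closer p b a, closer y b a, closer y b \<one>]"] by (simp add: blocked_def)

lemma finite_blocked [simp]: "finite (blocked p a b y)"
  by (simp add: blocked_def)

text \<open>
  If the third step is always blocked, counting forces \<open>blocked q x' r s = E - {x, x'}\<close> for all admissible
  first two steps \<open>x, q, x', r\<close>; these equalities determine the closing elements so rigidly that an
  injective map takes one value twice.
\<close>

lemma three_steps:
  assumes carr: "p \<in> carrier G" "a \<in> carrier G" "b \<in> carrier G" "E \<subseteq> carrier G" "U \<subseteq> carrier G"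
    and one: "\<one> \<notin> E" and cardE: "card E = 5" and cardU: "card U = 3"
  shows "\<exists>q r s x x' x''. U = {q, r, s} \<and> q \<noteq> r \<and> q \<noteq> s \<and> r \<noteq> s \<and>
    x \<in> E - blocked p a b q \<and> x' \<in> E - {x} - blocked b x q r \<and> x'' \<in> E - {x, x'} - blocked q x' r s"
proof (rule ccontr)
  assume no: "\<not> ?thesis"
  define P where "P q r s \<longleftrightarrow> U = {q, r, s} \<and> q \<noteq> r \<and> q \<noteq> s \<and> r \<noteq> s" for q r s
  have Pcarr: "q \<in> carrier G" "r \<in> carrier G" "s \<in> carrier G" if "P q r s" for q r s
    using that carr unfolding P_def by auto
  have Pswap: "P q s r" "P r s q" if "P q r s" for q r s
    using that unfolding P_def by auto
  have finE: "finite E" using cardE card.infinite by fastforce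
  define X where "X q = E - blocked p a b q" for q
  define W where "W q r x = E - {x} - blocked b x q r" for q r x
  have XE: "x \<in> E" "x \<in> carrier G" if "x \<in> X q" for x q
    using that carr unfolding X_def by auto
  have tri: "blocked q x' r s = E - {x, x'}" if "P q r s" "x \<in> X q" "x' \<in> W q r x" for q r s x x'
  proof -
    have "E - {x, x'} \<subseteq> blocked q x' r s"
      using no that unfolding P_def X_def W_def by blast
    moreover have "card (E - {x, x'}) = 3"
      using that cardE finE unfolding X_def W_def by (subst card_Diff_subset) auto
    ultimately show ?thesis
      using card_blocked_le[of q x' r s] by (metis card_seteq finite_blocked)
  qed
  have Xcard: "card (X q) \<ge> 2" for q
    using diff_card_le_card_Diff[of "blocked p a b q" E] card_blocked_le[of p a b q] cardE
    unfolding X_def by simp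
  have Wne: "\<exists>x'. x' \<in> W q r x" if "x \<in> X q" for q r x
  proof (rule ccontr)
    assume "\<not> ?thesis"
    then have "E - {x} \<subseteq> blocked b x q r" unfolding W_def by blast
    then have "card (E - {x}) \<le> 3"
      using card_blocked_le[of b x q r] card_mono[OF finite_blocked] le_trans by blast
    moreover have "card (E - {x}) = 4" using XE[OF that] cardE finE by simp
    ultimately show False by simp
  qed
  \<comment> \<open>By \<open>tri\<close>, \<open>closer s r \<one>\<close> lies in
    \<open>E - {x, x'}\<close> for every admissible \<open>x'\<close>, so it is never
    \<open>x'\<close> itself; and \<open>x' = closer r s \<one>\<close> would block
    \<open>\<one>\<close>, forcing \<open>\<one> \<in> E\<close>.\<close>
  have T: "closer s r \<one> \<in> E - {x}" "closer s r \<one> \<notin> W q r x" "closer r s \<one> \<notin> W q r x"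
    if P: "P q r s" and x: "x \<in> X q" for q r s x
  proof -
    obtain x' where x': "x' \<in> W q r x" using Wne x by blast
    show 1: "closer s r \<one> \<in> E - {x}" using tri[OF P x x'] unfolding blocked_def by blast
    show "closer s r \<one> \<notin> W q r x"
      using tri[OF P x, of "closer s r \<one>"] unfolding blocked_def by blast
    show "closer r s \<one> \<notin> W q r x"
      using tri[OF P x, of "closer r s \<one>"] one closer_closer[of r s \<one>] Pcarr[OF P]
      unfolding blocked_def by auto
  qed
  have inj: "closer u v x = closer u v y \<longleftrightarrow> x = y" "closer u v x = closer w v x \<longleftrightarrow> u = w"
    "closer u v x = closer u w x \<longleftrightarrow> v = w"
    if "u \<in> U \<union> {b}" "v \<in> U" "w \<in> U" "x \<in> E \<union> {\<one>}" "y \<in> E \<union> {\<one>}" for u v w x y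
  proof -
    have c: "u \<in> carrier G" "v \<in> carrier G" "w \<in> carrier G" "x \<in> carrier G" "y \<in> carrier G"
      using that carr by auto
    show "closer u v x = closer u v y \<longleftrightarrow> x = y" "closer u v x = closer w v x \<longleftrightarrow> u = w"
      "closer u v x = closer u w x \<longleftrightarrow> v = w"
      using c by (simp_all add: closer_eq_iff closer_left_eq_iff closer_right_eq_iff)
  qed
  \<comment> \<open>Both elements lie in \<open>E - {x}\<close> but are not admissible after
    \<open>x\<close>.\<close>
  have D: "closer s r \<one> \<in> blocked b x q r" "closer r s \<one> \<in> blocked b x q r"
    if "P q r s" "x \<in> X q" for q r s x
    using T[OF that] T(1)[OF Pswap(1)[OF that(1)] that(2)] unfolding W_def by auto
  have A: "closer r s \<one> \<in> {closer b q x, closer r q x}" if P: "P q r s" and x: "x \<in> X q" for q r s x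
  proof -
    have "closer r s \<one> \<noteq> closer r q \<one>" using P inj(3)[of r s q \<one> \<one>] unfolding P_def by blast
    then show ?thesis using D(2)[OF P x] unfolding blocked_def by blast
  qed
  \<comment> \<open>Take two elements of \<open>X q\<close>. By \<open>A\<close>, each of them is
    sent to \<open>closer r s \<one>\<close> by \<open>closer b q\<close> or
    \<open>closer r q\<close>; both maps are injective, so each takes this value at exactly one of
    the two. Exchanging \<open>r\<close> and \<open>s\<close> gives the remaining values.\<close>
  have key: "\<exists>x y. x \<in> X q \<and> y \<in> X q \<and> x \<noteq> y \<and> closer b q x = closer r s \<one> \<and> closer r q y = closer r s \<one>
      \<and> closer b q y = closer s r \<one> \<and> closer s q x = closer s r \<one> \<and> closer s r \<one> = closer r q \<one>"
    if P: "P q r s" for q r s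
  proof -
    obtain x1 x2 where x12: "x1 \<in> X q" "x2 \<in> X q" "x1 \<noteq> x2"
      using Xcard[of q] by (metis card_le_Suc0_iff_eq finE finite_Diff X_def not_less_eq_eq numeral_2_eq_2)
    have U: "q \<in> U" "r \<in> U" "s \<in> U" "q \<noteq> r" "q \<noteq> s" "r \<noteq> s" using P unfolding P_def by auto
    have E: "x \<in> E" if "x \<in> X q" for x using XE(1) that by blast
    have "closer b q x1 \<noteq> closer b q x2" "closer r q x1 \<noteq> closer r q x2"
      using inj(1)[of b q q x1 x2] inj(1)[of r q q x1 x2] U E x12 by auto
    then obtain x y where xy: "x \<in> X q" "y \<in> X q" "x \<noteq> y"
      and bx: "closer b q x = closer r s \<one>" and ry: "closer r q y = closer r s \<one>"
      using A[OF P x12(1)] A[OF P x12(2)] x12 by auto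
    have ne: "closer b q x \<noteq> closer b q y" "closer s q x \<noteq> closer s q y"
      using inj(1)[of b q q x y] inj(1)[of s q q x y] U E xy by auto
    have rs: "closer r q z \<noteq> closer s q z" if "z \<in> X q" for z
      using inj(2)[of r q s z z] U E[OF that] by auto
    have sy: "closer s r \<one> \<noteq> closer s q y"
      using ry rs[OF xy(2)] ne A[OF Pswap(1)[OF P] xy(1)] A[OF Pswap(1)[OF P] xy(2)] bx by auto
    then have "closer b q y = closer s r \<one>"
      using A[OF Pswap(1)[OF P] xy(2)] by auto
    moreover from this have "closer s q x = closer s r \<one>"
      using A[OF Pswap(1)[OF P] xy(1)] ne by auto
    moreover from this have "closer s r \<one> = closer r q \<one>"
      using D(1)[OF P xy(1)] calculation ne rs[OF xy(1)] unfolding blocked_def by auto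
    ultimately show ?thesis using xy bx ry by blast
  qed
  obtain q r s where P: "P q r s"
    using cardU unfolding P_def card_3_iff by auto
  have U: "q \<in> U" "r \<in> U" "s \<in> U" "q \<noteq> r" "q \<noteq> s" "r \<noteq> s" using P unfolding P_def by auto
  obtain x y where x: "x \<in> X q" and y: "y \<in> X q" and xy: "x \<noteq> y"
    and bx: "closer b q x = closer r s \<one>" and ry: "closer r q y = closer r s \<one>"
    and bry: "closer b q y = closer s r \<one>" and rq: "closer s r \<one> = closer r q \<one>"
    using key[OF P] by blast
  define \<alpha> \<beta> where "\<alpha> = closer s r \<one>" and "\<beta> = closer r s \<one>"
  note ab = \<alpha>_def[symmetric] \<beta>_def[symmetric]
  have \<alpha>: "\<alpha> \<in> E - {x, y}" and \<beta>: "\<beta> \<in> E - {x, y}"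
    using T(1)[OF P x] T(1)[OF P y] T(1)[OF Pswap(1)[OF P] x] T(1)[OF Pswap(1)[OF P] y] ab by auto
  have "\<alpha> \<noteq> \<beta>"
    using bx bry inj(1)[of b q q x y] U XE(1)[OF x] XE(1)[OF y] xy ab by auto
  moreover have "x \<in> E" "y \<in> E" using XE x y by auto
  ultimately have "card {x, y, \<alpha>, \<beta>} = 4" "{x, y, \<alpha>, \<beta>} \<subseteq> E" using \<alpha> \<beta> xy by auto
  \<comment> \<open>Only one element \<open>v\<close> of \<open>E\<close> is still unknown, so the
    admissible second steps can be listed.\<close>
  then have "card (E - {x, y, \<alpha>, \<beta>}) = 1" using cardE by (simp add: card_Diff_subset)
  then obtain v where "E - {x, y, \<alpha>, \<beta>} = {v}" by (metis card_1_singletonE)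
  then have E: "E = {x, y, v, \<alpha>, \<beta>}" "v \<notin> {x, y, \<alpha>, \<beta>}"
    using \<open>{x, y, \<alpha>, \<beta>} \<subseteq> E\<close> by auto
  have neq: "x \<noteq> y" "x \<noteq> v" "x \<noteq> \<alpha>" "x \<noteq> \<beta>" "y \<noteq> v" "y \<noteq> \<alpha>" "y \<noteq> \<beta>" "v \<noteq> \<alpha>" "v \<noteq> \<beta>" "\<alpha> \<noteq> \<beta>"
    using E(2) \<alpha> \<beta> \<open>\<alpha> \<noteq> \<beta>\<close> xy by auto
  have by': "closer b q y = \<alpha>" and bx': "closer b q x = \<beta>" and ry': "closer r q y = \<beta>"
    and rq': "closer r q \<one> = \<alpha>" and sr: "closer s r \<one> = \<alpha>"
    using bx bry ry rq unfolding \<alpha>_def \<beta>_def by simp_all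
  have Wy: "W q r y = {x, v}"
    unfolding W_def blocked_def by' ry' rq' using E(1) neq by auto
  have Wx: "W q r x = {y, v} - {closer r q x}"
    unfolding W_def blocked_def bx' rq' using E(1) neq by auto
  have B: "{closer q r z, closer s r z, \<alpha>} = E - {u, z}" if "u \<in> X q" "z \<in> W q r u" for u z
    using tri[OF P that] unfolding blocked_def sr .
  have Exy: "E - {y, x} = {v, \<beta>, \<alpha>}" "E - {x, y} = {v, \<beta>, \<alpha>}"
    and Eyv: "E - {y, v} = {x, \<beta>, \<alpha>}" and Exv: "E - {x, v} = {y, \<beta>, \<alpha>}"
    unfolding E(1) using neq by blast+
  have Byx: "{closer q r x, closer s r x, \<alpha>} = {v, \<beta>, \<alpha>}"
    using B[OF y, of x] Wy Exy by simp
  have Byv: "{closer q r v, closer s r v, \<alpha>} = {x, \<beta>, \<alpha>}"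
    using B[OF y, of v] Wy Eyv by simp
  have sinj: "closer s r z \<noteq> closer s r w" if "z \<in> E" "w \<in> E" "z \<noteq> w" for z w
    using inj(1)[of s r r z w] U that by auto
  \<comment> \<open>\<open>blocked q v r s\<close> does not depend on the first even element, but
    would have to equal both \<open>E - {y, v}\<close> and \<open>E - {x, v}\<close>.\<close>
  have "v \<notin> W q r x"
  proof
    assume "v \<in> W q r x"
    then have "{closer q r v, closer s r v, \<alpha>} = {y, \<beta>, \<alpha>}"
      using B[OF x, of v] Exv by simp
    then have "x \<in> {y, \<beta>, \<alpha>}" using Byv by blast
    then show False using neq by blast
  qed
  then have rx: "closer r q x = v" and "y \<in> W q r x" using Wx neq Wne[OF x, of r] by auto
  then have Bxy: "{closer q r y, closer s r y, \<alpha>} = {v, \<beta>, \<alpha>}"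
    using B[OF x, of y] Exy by simp
  have "closer q r v = x"
    using rx closer_closer[of r q x] Pcarr[OF P] XE(2)[OF x] by simp
  moreover have "\<beta> \<in> {closer q r v, closer s r v, \<alpha>}" using Byv by blast
  ultimately have sv: "closer s r v = \<beta>" using neq by auto
  \<comment> \<open>It remains to see that \<open>closer s r\<close> must send both \<open>x\<close>
    and \<open>y\<close> to \<open>v\<close>, against injectivity.\<close>
  have "x \<in> E" "y \<in> E" "v \<in> E" using E(1) by auto
  then have "closer s r x \<noteq> \<beta>" "closer s r y \<noteq> \<beta>" and sxy: "closer s r x \<noteq> closer s r y"
    using sinj[of x v] sinj[of y v] sinj[of x y] sv neq by auto
  moreover have "closer s r x \<noteq> \<alpha>" "closer s r y \<noteq> \<alpha>"
    using inj(1)[of s r r x \<one>] inj(1)[of s r r y \<one>] sr U \<open>x \<in> E\<close> \<open>y \<in> E\<close> one by auto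
  moreover have "closer s r x \<in> {v, \<beta>, \<alpha>}" "closer s r y \<in> {v, \<beta>, \<alpha>}"
    using Byx Bxy by blast+
  ultimately show False by auto
qed
end

section \<open>Good sequences with at least nine elements of each parity\<close>

text \<open>Shorter windows are left out: for alternating lists without \<open>\<one>\<close>, a
  window of length one or two never has product \<open>\<one>\<close>.\<close>

fun (in monoid) good :: "'a list \<Rightarrow> bool" where
  "good (w # x # y # z # ys) \<longleftrightarrow> w \<otimes> x \<otimes> y \<noteq> \<one> \<and> w \<otimes> x \<otimes> y \<otimes> z \<noteq> \<one> \<and> good (x # y # z # ys)"
| "good [x, y, z] \<longleftrightarrow> x \<otimes> y \<otimes> z \<noteq> \<one>"
| "good _ \<longleftrightarrow> True"

lemma (in monoid) good_snoc:
  "good (ys @ [w, x, y, z]) \<longleftrightarrow> good (ys @ [w, x, y]) \<and> w \<otimes> x \<otimes> y \<otimes> z \<noteq> \<one> \<and> x \<otimes> y \<otimes> z \<noteq> \<one>"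
proof (induction ys)
  case (Cons a ys)
  then show ?case by (cases ys; cases "tl ys"; cases "tl (tl ys)") auto
qed auto

text \<open>All that is used of the semidirect product. Since \<open>ord\<close> encodes infinite
  order as \<open>0\<close>, \<open>odd_ord\<close> also makes every even element have finite
  order.\<close>

locale parity_group = group +
  fixes odd_el :: "'a \<Rightarrow> bool"
  assumes odd_mult: "x \<in> carrier G \<Longrightarrow> y \<in> carrier G \<Longrightarrow> odd_el (x \<otimes> y) \<longleftrightarrow> odd_el x \<noteq> odd_el y"
    and odd_ord: "x \<in> carrier G \<Longrightarrow> \<not> odd_el x \<Longrightarrow> odd (ord x)"
begin

definition seq :: "'a list \<Rightarrow> bool"
  where "seq ys \<longleftrightarrow> set ys \<subseteq> carrier G \<and> distinct ys \<and>
    successively (\<lambda>x y. odd_el x \<noteq> odd_el y) ys \<and> good ys"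

lemma not_odd_one [simp]: "\<not> odd_el \<one>"
  using odd_mult[of \<one> \<one>] by simp

lemma mult_one_commute:
  "x \<in> carrier G \<Longrightarrow> y \<in> carrier G \<Longrightarrow> x \<otimes> y = \<one> \<longleftrightarrow> y \<otimes> x = \<one>"
  using inv_comm by blast

text \<open>After a rotation, a product of three is a product of four with one factor
  \<open>\<one>\<close>, so \<open>closer\<close> describes windows of both lengths.\<close>

lemma triple_iff:
  assumes "u \<in> carrier G" "x \<in> carrier G" "v \<in> carrier G"
  shows "u \<otimes> x \<otimes> v = \<one> \<longleftrightarrow> x = closer v u \<one>"
proof -
  have "u \<otimes> x \<otimes> v = \<one> \<longleftrightarrow> v \<otimes> \<one> \<otimes> u \<otimes> x = \<one>"
    using assms mult_one_commute[of "u \<otimes> x" v] by (simp add: m_assoc)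
  then show ?thesis using assms closer_iff[of v u \<one> x] by simp
qed

text \<open>A product equal to \<open>\<one>\<close> stays so under cyclic rotation, which brings
  any factor to the end.\<close>

lemma quad_iff:
  assumes "w \<in> carrier G" "x \<in> carrier G" "y \<in> carrier G" "z \<in> carrier G"
  shows "w \<otimes> x \<otimes> y \<otimes> z = \<one> \<longleftrightarrow> w = closer x z y" "w \<otimes> x \<otimes> y \<otimes> z = \<one> \<longleftrightarrow> x = closer y w z"
    "w \<otimes> x \<otimes> y \<otimes> z = \<one> \<longleftrightarrow> y = closer z x w" "w \<otimes> x \<otimes> y \<otimes> z = \<one> \<longleftrightarrow> z = closer w y x"
proof -
  show "w \<otimes> x \<otimes> y \<otimes> z = \<one> \<longleftrightarrow> w = closer x z y"
    using assms mult_one_commute[of w "x \<otimes> y \<otimes> z"] closer_iff[of x z y w] by (simp add: m_assoc)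
  show "w \<otimes> x \<otimes> y \<otimes> z = \<one> \<longleftrightarrow> x = closer y w z"
    using assms mult_one_commute[of "w \<otimes> x" "y \<otimes> z"] closer_iff[of y w z x] by (simp add: m_assoc)
  show "w \<otimes> x \<otimes> y \<otimes> z = \<one> \<longleftrightarrow> y = closer z x w"
    using assms mult_one_commute[of "w \<otimes> x \<otimes> y" z] closer_iff[of z x w y] by (simp add: m_assoc)
  show "w \<otimes> x \<otimes> y \<otimes> z = \<one> \<longleftrightarrow> z = closer w y x"
    using assms closer_iff[of w y x z] by simp
qed

lemma odd_triple:
  assumes "x \<in> carrier G" "y \<in> carrier G" "z \<in> carrier G" "\<not> odd_el x" "odd_el y" "\<not> odd_el z"
  shows "x \<otimes> y \<otimes> z \<noteq> \<one>"
  using assms odd_mult[of "x \<otimes> y" z] odd_mult[of x y] not_odd_one by fastforce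

text \<open>The other new window \<open>a, b, x\<close> has odd product, so only the window of
  length four can obstruct.\<close>

lemma seq_snoc_even:
  assumes "seq (ys @ [p, a, b])" "odd_el b" "x \<in> carrier G" "\<not> odd_el x"
    "x \<notin> set (ys @ [p, a, b])" "x \<noteq> closer p b a"
  shows "seq (ys @ [p, a, b, x])"
proof -
  have "p \<in> carrier G" "a \<in> carrier G" "b \<in> carrier G" "\<not> odd_el a"
    using assms(1,2) by (auto simp: seq_def successively_append_iff)
  then show ?thesis
    using assms quad_iff(4)[of p a b x] odd_triple[of a b x]
    by (auto simp: seq_def good_snoc successively_append_iff)
qed

lemma seq_step:
  assumes "seq (ys @ [p, a, b])" "odd_el b" "x \<in> carrier G" "\<not> odd_el x" "y \<in> carrier G" "odd_el y"
    "x \<notin> set (ys @ [p, a, b])" "y \<notin> set (ys @ [p, a, b])" "x \<notin> blocked p a b y"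
  shows "seq (ys @ [p, a, b, x, y])"
proof -
  have carr: "p \<in> carrier G" "a \<in> carrier G" "b \<in> carrier G" "\<not> odd_el a"
    using assms(1,2) by (auto simp: seq_def successively_append_iff)
  have "seq (ys @ [p, a, b, x])" using seq_snoc_even assms unfolding blocked_def by auto
  then show ?thesis
    using assms carr quad_iff(3)[of a b x y] triple_iff[of b x y] good_snoc[of "ys @ [p]" a b x y]
    by (auto simp: seq_def successively_append_iff blocked_def)
qed

lemma seq_cons_even:
  assumes "seq (p # a # b # ys)" "odd_el p" "x \<in> carrier G" "\<not> odd_el x"
    "x \<notin> set (p # a # b # ys)" "x \<noteq> closer p b a"
  shows "seq (x # p # a # b # ys)"
  using assms quad_iff(1)[of x p a b] odd_triple[of x p a] by (auto simp: seq_def)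

text \<open>Both new windows are expressed as conditions on \<open>x\<close>, so \<open>r\<close>
  can be fixed in advance and the unsuitable even elements placed elsewhere.\<close>

lemma seq_cons_odd:
  assumes "seq (x # p # a # ys)" "\<not> odd_el x" "r \<in> carrier G" "odd_el r"
    "r \<notin> set (x # p # a # ys)" "x \<noteq> closer p r a" "x \<noteq> closer p r \<one>"
  shows "seq (r # x # p # a # ys)"
  using assms quad_iff(2)[of r x p a] triple_iff[of r x p] by (auto simp: seq_def)

text \<open>The order of the even elements is prescribed and the odd ones are chosen. Three
  conditions exclude at most one odd element each, so four candidates suffice at every step. The
  condition on \<open>hd xs\<close> does not involve the odd element to be chosen next; it is
  arranged one step earlier.\<close>

lemma place_evens:
  assumes "seq (ys @ [p, a, b])" "odd_el b"
    and "set xs \<subseteq> carrier G" "\<forall>x \<in> set xs. \<not> odd_el x" "distinct xs" "set xs \<inter> set (ys @ [p, a, b]) = {}"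
    and "U \<subseteq> carrier G" "\<forall>y \<in> U. odd_el y" "finite U" "U \<inter> set (ys @ [p, a, b]) = {}"
    and "card U \<ge> length xs + 3" "xs = [] \<or> hd xs \<noteq> closer p b a"
  shows "\<exists>ws zs p' a' b' V. zs @ [p', a', b'] = ys @ [p, a, b] @ ws \<and> seq (zs @ [p', a', b']) \<and> odd_el b' \<and>
    V \<subseteq> U \<and> card V = length xs \<and> set ws = set xs \<union> V"
  using assms
proof (induction xs arbitrary: ys p a b U)
  case Nil
  show ?case
    by (rule exI[of _ "[]"], rule exI[of _ ys], rule exI[of _ p], rule exI[of _ a], rule exI[of _ b],
        rule exI[of _ "{}"]) (use Nil in auto)
next
  case (Cons x xs)
  have carr: "p \<in> carrier G" "a \<in> carrier G" "b \<in> carrier G" "x \<in> carrier G"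
    using Cons.prems(1,3) by (auto simp: seq_def)
  \<comment> \<open>The next even element. After the last one, the default \<open>x\<close> excludes
    at most one more \<open>y\<close>, which the count allows.\<close>
  define h where "h = (if xs = [] then x else hd xs)"
  \<comment> \<open>The first two sets would block \<open>x\<close> before \<open>y\<close>; the
    third would make \<open>h\<close> close the window that starts at \<open>b\<close>.\<close>
  define bad where "bad = (\<lambda>y. closer y b a) -` {x} \<inter> U \<union> (\<lambda>y. closer y b \<one>) -` {x} \<inter> U \<union> (\<lambda>y. closer b y x) -` {h} \<inter> U"
  have inj: "inj_on (\<lambda>y. closer y b a) U" "inj_on (\<lambda>y. closer y b \<one>) U" "inj_on (\<lambda>y. closer b y x) U"
    using carr Cons.prems(7) closer_left_eq_iff closer_right_eq_iff one_closed by (meson inj_onI subsetD)+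
  have "card bad \<le> 1 + 1 + 1"
    unfolding bad_def
    by (intro order.trans[OF card_Un_le] add_mono; rule order.trans[OF card_vimage_inj_on_le]) (use inj in auto)
  then have "card bad < card U" using Cons.prems(11) by simp
  then obtain y where y: "y \<in> U" "y \<notin> bad"
    by (metis Cons.prems(9) card_mono finite_subset leD subsetI bad_def Un_least inf_le2)
  have blocked: "x \<notin> blocked p a b y" and h: "h \<noteq> closer b y x"
    using y Cons.prems(12) unfolding bad_def blocked_def by auto
  have "y \<notin> set (ys @ [p, a, b])" "y \<in> carrier G" "odd_el y" using Cons.prems(7,8,10) y(1) by auto
  then have seq: "seq ((ys @ [p, a]) @ [b, x, y])"
    using seq_step[OF Cons.prems(1,2), of x y] Cons.prems(3,4,6) blocked by auto
  have "\<exists>ws zs p' a' b' V. zs @ [p', a', b'] = (ys @ [p, a]) @ [b, x, y] @ ws \<and> seq (zs @ [p', a', b']) \<and> odd_el b' \<and>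
    V \<subseteq> U - {y} \<and> card V = length xs \<and> set ws = set xs \<union> V"
  proof (rule Cons.IH[OF seq])
    show "length xs + 3 \<le> card (U - {y})" using Cons.prems(9,11) y(1) by simp
    show "xs = [] \<or> hd xs \<noteq> closer b y x" using h unfolding h_def by auto
    have "y \<notin> set xs" using Cons.prems(4,8) y(1) by auto
    then show "set xs \<inter> set ((ys @ [p, a]) @ [b, x, y]) = {}" using Cons.prems(5,6) by auto
    have "x \<notin> U" using Cons.prems(4,8) by auto
    then show "(U - {y}) \<inter> set ((ys @ [p, a]) @ [b, x, y]) = {}" using Cons.prems(10) by auto
  qed (use Cons.prems y in auto)
  then obtain ws zs p' a' b' V where *: "zs @ [p', a', b'] = (ys @ [p, a]) @ [b, x, y] @ ws" "seq (zs @ [p', a', b'])" "odd_el b'"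
    "V \<subseteq> U - {y}" "card V = length xs" "set ws = set xs \<union> V" by blast
  have "finite V" "y \<notin> V" using *(4) Cons.prems(9) finite_subset by blast+
  then have "card (insert y V) = length (x # xs)" using *(5) by simp
  moreover have "zs @ [p', a', b'] = ys @ [p, a, b] @ x # y # ws" using *(1) by simp
  moreover have "set (x # y # ws) = set (x # xs) \<union> insert y V" "insert y V \<subseteq> U" using * y(1) by auto
  ultimately show ?case using *(2,3) by metis
qed

text \<open>The list is built outwards from \<open>p, a, b\<close>; it ends up as
  \<open>r, c, p, a, b\<close>, then \<open>ws\<close>, then
  \<open>x, q, x', s, x'', t, d\<close>.\<close>

lemma seq_large:
  assumes A: "A \<subseteq> carrier G" "\<forall>x \<in> A. \<not> odd_el x" "\<one> \<notin> A" and B: "B \<subseteq> carrier G" "\<forall>y \<in> B. odd_el y"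
    and card: "card A = n" "card B = n" and n: "n \<ge> 9"
  shows "\<exists>ys. seq ys \<and> set ys = A \<union> B"
proof -
  have fin: "finite A" "finite B" using card n card.infinite by fastforce+
  obtain B3 where "B3 \<subseteq> B" "card B3 = 3" using card n obtain_subset_with_card_n[of 3 B] by auto
  then obtain p b r where pbr: "p \<in> B" "b \<in> B" "r \<in> B" "p \<noteq> b" "p \<noteq> r" "b \<noteq> r"
    unfolding card_3_iff by auto
  have "\<not> A \<subseteq> {closer b p \<one>}" using card n card_mono[of "{closer b p \<one>}" A] by auto
  then obtain a where a: "a \<in> A" "a \<noteq> closer b p \<one>" by blast
  have carr: "p \<in> carrier G" "b \<in> carrier G" "r \<in> carrier G" "a \<in> carrier G" using pbr a A B by auto
  have par: "odd_el p" "odd_el b" "odd_el r" "\<not> odd_el a" using pbr a A B by auto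
  have seq0: "seq ([] @ [p, a, b])"
    using carr par pbr a triple_iff[of p a b] by (auto simp: seq_def)
  \<comment> \<open>The even elements that cannot stand between \<open>r\<close> and
    \<open>p, a, b\<close>.\<close>
  define Z where "Z = {closer p b a, closer p r a, closer p r \<one>}"
  have "card Z \<le> 3" using card_length[of "[closer p b a, closer p r a, closer p r \<one>]"] by (simp add: Z_def)
  have "card (A - {a}) = n - 1" using card fin a by simp
  moreover have "finite Z" unfolding Z_def by simp
  ultimately have "card (A - {a} - Z) \<ge> 5"
    using diff_card_le_card_Diff[of Z "A - {a}"] \<open>card Z \<le> 3\<close> n by linarith
  then obtain E where E: "E \<subseteq> A - {a} - Z" "card E = 5" by (rule obtain_subset_with_card_n)
  \<comment> \<open>Every element of \<open>A\<close> in \<open>Z\<close> other than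
    \<open>a\<close> falls into \<open>R\<close> and is placed first, so any element of
    \<open>E\<close> may later go to the left of \<open>p\<close>.\<close>
  define R where "R = A - {a} - E"
  have cardR: "card R = n - 6"
    using E \<open>card (A - {a}) = n - 1\<close> fin finite_subset[of E A] unfolding R_def
    by (subst card_Diff_subset) auto
  have "\<not> R \<subseteq> {closer p b a}" using cardR n card_mono[of "{closer p b a}" R] by auto
  then obtain h where h: "h \<in> R" "h \<noteq> closer p b a" by blast
  obtain xs' where xs': "set xs' = R - {h}" "distinct xs'"
    using finite_distinct_list fin unfolding R_def by (metis finite_Diff)
  define xs where "xs = h # xs'"
  have "set xs = R" "distinct xs" "hd xs \<noteq> closer p b a" using xs' h unfolding xs_def by auto
  with cardR distinct_card[of xs] have xs: "set xs = R" "distinct xs" "hd xs \<noteq> closer p b a" "length xs = n - 6"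
    by simp_all
  define U where "U = B - {p, b, r}"
  have cardU: "card U = n - 3" unfolding U_def using pbr card fin by (subst card_Diff_subset) auto
  have AB: "A \<inter> B = {}" using A B by auto
  have "\<exists>ws zs p' a' b' V. zs @ [p', a', b'] = [] @ [p, a, b] @ ws \<and> seq (zs @ [p', a', b']) \<and> odd_el b' \<and>
    V \<subseteq> U \<and> card V = length xs \<and> set ws = set xs \<union> V"
  proof (rule place_evens[OF seq0 par(2)])
    show "set xs \<inter> set ([] @ [p, a, b]) = {}" "U \<inter> set ([] @ [p, a, b]) = {}"
      using xs(1) AB pbr a unfolding R_def U_def by auto
    show "length xs + 3 \<le> card U" using xs(4) cardU n by simp
  qed (use xs A B fin in \<open>auto simp: R_def U_def\<close>)
  then obtain ws zs p' a' b' V where zs: "zs @ [p', a', b'] = p # a # b # ws" "seq (zs @ [p', a', b'])" "odd_el b'"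
    and V: "V \<subseteq> U" "card V = n - 6" "set ws = R \<union> V" using xs by auto
  have setzs: "set (zs @ [p', a', b']) = {p, a, b} \<union> R \<union> V" using zs(1) V(3) by auto
  have carr': "p' \<in> carrier G" "a' \<in> carrier G" "b' \<in> carrier G" using zs(2) by (auto simp: seq_def)
  have "card (U - V) = 3"
    using V cardU n fin finite_subset[of V B] by (subst card_Diff_subset) (auto simp: U_def)
  then obtain q s t x x' x'' where qst: "U - V = {q, s, t}" "q \<noteq> s" "q \<noteq> t" "s \<noteq> t"
    and x: "x \<in> E - blocked p' a' b' q" "x' \<in> E - {x} - blocked b' x q s" "x'' \<in> E - {x, x'} - blocked q x' s t"
    using three_steps[OF carr', of E "U - V"] E A B unfolding U_def by blast
  have EAB: "E \<subseteq> A" "E \<inter> ({p, a, b} \<union> R \<union> V) = {}" "E \<inter> B = {}"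
    using E AB pbr V unfolding R_def U_def by auto
  have qstU: "q \<in> U - V" "s \<in> U - V" "t \<in> U - V" using qst by auto
  then have qst': "q \<in> carrier G" "s \<in> carrier G" "t \<in> carrier G" "odd_el q" "odd_el s" "odd_el t"
    "q \<in> B" "s \<in> B" "t \<in> B" "q \<notin> A" "s \<notin> A" "t \<notin> A"
    using B AB unfolding U_def by auto
  have notin: "q \<notin> set (zs @ [p', a', b'])" "s \<notin> set (zs @ [p', a', b'])" "t \<notin> set (zs @ [p', a', b'])"
    unfolding setzs using qstU qst' a unfolding U_def R_def by auto
  have x': "x \<in> E" "x' \<in> E" "x'' \<in> E" "x \<noteq> x'" "x \<noteq> x''" "x' \<noteq> x''" using x by auto
  have Ex: "y \<in> carrier G" "\<not> odd_el y" "y \<notin> set (zs @ [p', a', b'])" "y \<noteq> q" "y \<noteq> s" "y \<noteq> t" "y \<noteq> r"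
    if "y \<in> E" for y
    using EAB that A qst' pbr unfolding setzs by auto
  have 1: "seq ((zs @ [p', a']) @ [b', x, q])"
    using seq_step[OF zs(2,3), of x q] Ex x x' qst' notin by auto
  have 2: "seq ((zs @ [p', a', b', x]) @ [q, x', s])"
    using seq_step[OF 1, of x' s] Ex x x' qst qst' notin by auto
  have 3: "seq ((zs @ [p', a', b', x, q, x']) @ [s, x'', t])"
    using seq_step[OF 2, of x'' t] Ex x x' qst qst' notin by auto
  have "card (E - {x, x', x''}) = 2" using x' E(2) by (subst card_Diff_subset) auto
  then obtain c d where cd: "E - {x, x', x''} = {c, d}" "c \<noteq> d" unfolding card_2_iff by auto
  \<comment> \<open>Only one even element is forbidden after \<open>t\<close>, so one of the last
    two fits there.\<close>
  then have "\<exists>c d. E - {x, x', x''} = {c, d} \<and> c \<noteq> d \<and> d \<noteq> closer s t x''" by (metis insert_commute)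
  then obtain c d where cd: "E - {x, x', x''} = {c, d}" "c \<noteq> d" "d \<noteq> closer s t x''" by blast
  have cd': "c \<in> E" "d \<in> E" "c \<notin> {x, x', x'', d}" "d \<notin> {x, x', x''}" using cd by auto
  have 4: "seq (zs @ [p', a', b', x, q, x', s, x'', t, d])"
    using seq_snoc_even[OF 3 qst'(6), of d] Ex[OF cd'(2)] cd(3) cd'(4) by auto
  define vs where "vs = ws @ [x, q, x', s, x'', t, d]"
  have "p # a # b # vs = (p # a # b # ws) @ [x, q, x', s, x'', t, d]" by (simp add: vs_def)
  also have "\<dots> = zs @ [p', a', b', x, q, x', s, x'', t, d]" unfolding zs(1)[symmetric] by simp
  finally have vs: "seq (p # a # b # vs)" "set (p # a # b # vs) = set (zs @ [p', a', b']) \<union> {x, q, x', s, x'', t, d}"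
    using 4 by auto
  have cn: "c \<notin> set (p # a # b # vs)"
    unfolding vs(2) using Ex[OF cd'(1)] cd'(3) by auto
  have cZ: "c \<noteq> closer p b a" "c \<noteq> closer p r a" "c \<noteq> closer p r \<one>" using cd'(1) E(1) unfolding Z_def by auto
  have 5: "seq (c # p # a # b # vs)"
    using seq_cons_even[OF vs(1) par(1) Ex(1,2)[OF cd'(1)] cn cZ(1)] .
  have "r \<notin> A" "r \<notin> U" using pbr(3) AB unfolding U_def by auto
  then have "r \<notin> set (c # p # a # b # vs)"
    unfolding list.set(2)[of c] vs(2) setzs using pbr V(1) qstU EAB(1) cd'(1,2) x'(1-3) a(1) unfolding R_def by blast
  then have 6: "seq (r # c # p # a # b # vs)"
    using seq_cons_odd[OF 5 Ex(2)[OF cd'(1)] carr(3) par(3)] cZ(2,3) by blast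
  have "set (r # c # p # a # b # vs) = {r, c} \<union> ({p, a, b} \<union> R \<union> V) \<union> {x, q, x', s, x'', t, d}"
    using vs(2) setzs by auto
  also have "\<dots> = {a} \<union> R \<union> ({x, x', x''} \<union> {c, d}) \<union> ({p, b, r} \<union> (V \<union> {q, s, t}))" by auto
  also have "\<dots> = {a} \<union> R \<union> E \<union> ({p, b, r} \<union> U)"
    using cd(1) x' qst(1) V(1) by auto
  also have "\<dots> = A \<union> B"
    using EAB a pbr unfolding R_def U_def by auto
  finally show ?thesis using 6 by blast
qed

end

section \<open>Four elements of each parity\<close>

text \<open>An index type with four elements, over which quantifiers expand into finitely many
  propositional instances.\<close>

datatype idx = I0 | I1 | I2 | I3

lemma all_idx: "(\<forall>i. P i) \<longleftrightarrow> P I0 \<and> P I1 \<and> P I2 \<and> P I3"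
  by (metis idx.exhaust)

lemma all_distinct_idx:
  "(\<forall>i j k l. distinct [i, j, k, l] \<longrightarrow> P i j k l) \<longleftrightarrow>
    P I0 I1 I2 I3 \<and> P I0 I1 I3 I2 \<and> P I0 I2 I1 I3 \<and> P I0 I2 I3 I1 \<and> P I0 I3 I1 I2 \<and> P I0 I3 I2 I1 \<and>
    P I1 I0 I2 I3 \<and> P I1 I0 I3 I2 \<and> P I1 I2 I0 I3 \<and> P I1 I2 I3 I0 \<and> P I1 I3 I0 I2 \<and> P I1 I3 I2 I0 \<and>
    P I2 I0 I1 I3 \<and> P I2 I0 I3 I1 \<and> P I2 I1 I0 I3 \<and> P I2 I1 I3 I0 \<and> P I2 I3 I0 I1 \<and> P I2 I3 I1 I0 \<and>
    P I3 I0 I1 I2 \<and> P I3 I0 I2 I1 \<and> P I3 I1 I0 I2 \<and> P I3 I1 I2 I0 \<and> P I3 I2 I0 I1 \<and> P I3 I2 I1 I0"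
  unfolding all_idx by simp

lemma at_most_one_idx:
  "(\<forall>i j. P i \<longrightarrow> P j \<longrightarrow> i = j) \<longleftrightarrow>
    (\<not> P I0 \<or> \<not> P I1) \<and> (\<not> P I0 \<or> \<not> P I2) \<and> (\<not> P I0 \<or> \<not> P I3) \<and>
    (\<not> P I1 \<or> \<not> P I2) \<and> (\<not> P I1 \<or> \<not> P I3) \<and> (\<not> P I2 \<or> \<not> P I3)"
  unfolding all_idx by auto

text \<open>The eight conditions are the windows of \<open>b0, a0, b1, a1, b2, a2, b3, a3\<close>
  not settled by parity, those beginning with an even element being rotated. Through
  \<open>rot\<close>, the hypotheses \<open>Q1\<close> and \<open>Q2\<close> also give uniqueness of
  the other two arguments. A counterexample would satisfy one clause for each of the
  \<open>24 * 24\<close> arrangements together with these constraints, and this is propositionally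
  inconsistent.\<close>

lemma arrangement_idx:
  fixes T :: "idx \<Rightarrow> idx \<Rightarrow> idx \<Rightarrow> bool" and Q :: "idx \<Rightarrow> idx \<Rightarrow> idx \<Rightarrow> idx \<Rightarrow> bool"
  assumes rot: "\<And>u a v b. Q u a v b \<longleftrightarrow> Q v b u a"
    and Q1: "\<forall>u v. u \<noteq> v \<longrightarrow> (\<forall>a b b'. Q u a v b \<longrightarrow> Q u a v b' \<longrightarrow> b = b')"
    and Q2: "\<forall>a b. a \<noteq> b \<longrightarrow> (\<forall>u v v'. Q u a v b \<longrightarrow> Q u a v' b \<longrightarrow> v = v')"
    and T1: "\<forall>u v a a'. T u a v \<longrightarrow> T u a' v \<longrightarrow> a = a'"
    and T2: "\<forall>u a v v'. T u a v \<longrightarrow> T u a v' \<longrightarrow> v = v'"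
    and T3: "\<forall>v a u u'. T u a v \<longrightarrow> T u' a v \<longrightarrow> u = u'"
    and TQ: "\<forall>u v. u \<noteq> v \<longrightarrow> (\<forall>a b. a \<noteq> b \<longrightarrow> \<not> T u a v \<or> \<not> Q u a v b)"
    and free: "\<not> T I0 I0 I1" "\<forall>b. \<not> Q I0 I0 I1 b"
  shows "\<exists>b0 b1 b2 b3. distinct [b0, b1, b2, b3] \<and> (\<exists>a0 a1 a2 a3. distinct [a0, a1, a2, a3] \<and>
      \<not> T b0 a0 b1 \<and> \<not> Q b0 a0 b1 a1 \<and> \<not> Q b1 a1 b2 a0 \<and> \<not> T b1 a1 b2 \<and> \<not> Q b1 a1 b2 a2 \<and>
      \<not> Q b2 a2 b3 a1 \<and> \<not> T b2 a2 b3 \<and> \<not> Q b2 a2 b3 a3)"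
proof (rule ccontr)
  assume "\<not> ?thesis"
  then have *: "\<forall>b0 b1 b2 b3. distinct [b0, b1, b2, b3] \<longrightarrow> (\<forall>a0 a1 a2 a3. distinct [a0, a1, a2, a3] \<longrightarrow>
      T b0 a0 b1 \<or> Q b0 a0 b1 a1 \<or> Q b1 a1 b2 a0 \<or> T b1 a1 b2 \<or> Q b1 a1 b2 a2 \<or>
      Q b2 a2 b3 a1 \<or> T b2 a2 b3 \<or> Q b2 a2 b3 a3)"
    by blast
  note * = *[unfolded all_distinct_idx]
  note ground = Q1 Q2 T1 T2 T3 TQ free(2)
  note ground = ground[unfolded at_most_one_idx]
  note ground = ground[simplified all_idx idx.distinct simp_thms not_False_eq_True]
  \<comment> \<open>As \<open>rot\<close> is used for ordered rewriting, it identifies the atoms \<open>Q u a v b\<close> and \<open>Q v b u a\<close>.\<close>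
  note facts = * ground free(1)
  note facts = facts[simplified rot]
  show False using facts by sat
qed

lemma UNIV_idx: "UNIV = {I0, I1, I2, I3}"
  using idx.exhaust by auto

lemma enumerate_idx:
  assumes "card S = 4" "x \<in> S" "y \<in> S" "x \<noteq> y"
  shows "\<exists>f :: idx \<Rightarrow> 'a. inj f \<and> range f = S \<and> f I0 = x \<and> f I1 = y"
proof -
  have "card (S - {x, y}) = 2" using assms by (subst card_Diff_subset) auto
  then obtain z w where zw: "S - {x, y} = {z, w}" "z \<noteq> w" unfolding card_2_iff by auto
  define f where "f = case_idx x y z w"
  have "z \<notin> {x, y}" "w \<notin> {x, y}" using zw by auto
  then have "inj f" unfolding f_def inj_def using zw(2) assms(4) by (auto split: idx.splits)
  moreover have "range f = {x, y, z, w}" unfolding f_def UNIV_idx by simp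
  then have "range f = S" using zw(1) assms(2,3) by auto
  ultimately show ?thesis by (intro exI[of _ f]) (simp add: f_def)
qed

section \<open>Four elements of each parity: the unsaturated case\<close>

context parity_group
begin

text \<open>The hypothesis on \<open>closer u v a\<close> says that \<open>u, a, v\<close> neither
  has product \<open>\<one>\<close> nor is closed by an element of \<open>A\<close>. This is the
  assumption \<open>free\<close> of \<open>arrangement_idx\<close> with \<open>u\<close>,
  \<open>v\<close> and \<open>a\<close> numbered first.\<close>

lemma seq_unsaturated_4:
  assumes A: "A \<subseteq> carrier G" "\<forall>x \<in> A. \<not> odd_el x" "\<one> \<notin> A" "card A = 4"
    and B: "B \<subseteq> carrier G" "\<forall>y \<in> B. odd_el y" "card B = 4"
    and uv: "u \<in> B" "v \<in> B" "u \<noteq> v" and a: "a \<in> A" "closer u v a \<notin> insert \<one> A"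
  shows "\<exists>ys. seq ys \<and> set ys = A \<union> B"
proof -
  \<comment> \<open>\<open>enumerate_idx\<close> prescribes two values; for \<open>A\<close> the
    second one is arbitrary.\<close>
  have "\<not> A \<subseteq> {a}" using A(4) card_mono[of "{a}" A] by auto
  then obtain c where "c \<in> A" "a \<noteq> c" by blast
  then obtain f :: "idx \<Rightarrow> 'a" where f: "inj f" "range f = A" "f I0 = a"
    using enumerate_idx[OF A(4) a(1)] by metis
  obtain g :: "idx \<Rightarrow> 'a" where g: "inj g" "range g = B" "g I0 = u" "g I1 = v"
    using enumerate_idx[OF B(3) uv] by metis
  have fc [simp]: "f i \<in> carrier G" "\<not> odd_el (f i)" "f i \<noteq> \<one>" for i
    using A(1-3) rangeI[of f i] unfolding f(2) by auto
  have gc [simp]: "g i \<in> carrier G" "odd_el (g i)" for i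
    using B(1,2) rangeI[of g i] unfolding g(2) by auto
  define T where "T i j k \<longleftrightarrow> g i \<otimes> f j \<otimes> g k = \<one>" for i j k
  define Q where "Q i j k l \<longleftrightarrow> g i \<otimes> f j \<otimes> g k \<otimes> f l = \<one>" for i j k l
  have rot: "g i \<otimes> f j \<otimes> g k \<otimes> f l = \<one> \<longleftrightarrow> g k \<otimes> f l \<otimes> g i \<otimes> f j = \<one>" for i j k l
    using mult_one_commute[of "g i \<otimes> f j" "g k \<otimes> f l"] by (simp add: m_assoc)
  have rot': "f i \<otimes> g j \<otimes> f k \<otimes> g l = \<one> \<longleftrightarrow> Q j k l i" for i j k l
    using mult_one_commute[of "f i" "g j \<otimes> f k \<otimes> g l"] unfolding Q_def by (simp add: m_assoc)
  have T: "T i j k \<longleftrightarrow> f j = closer (g k) (g i) \<one>" for i j k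
    unfolding T_def by (simp add: triple_iff)
  have Q: "Q i j k l \<longleftrightarrow> f l = closer (g i) (g k) (f j)" for i j k l
    unfolding Q_def by (simp add: quad_iff(4))
  have fe: "f i = f j \<longleftrightarrow> i = j" and ge: "g i = g j \<longleftrightarrow> i = j" for i j
    using f(1) g(1) by (simp_all add: inj_eq)
  obtain b0 b1 b2 b3 a0 a1 a2 a3 where dist: "distinct [b0, b1, b2, b3]" "distinct [a0, a1, a2, a3]" and
    ok: "\<not> T b0 a0 b1" "\<not> Q b0 a0 b1 a1" "\<not> Q b1 a1 b2 a0" "\<not> T b1 a1 b2" "\<not> Q b1 a1 b2 a2"
      "\<not> Q b2 a2 b3 a1" "\<not> T b2 a2 b3" "\<not> Q b2 a2 b3 a3"
  proof -
    have "\<exists>b0 b1 b2 b3. distinct [b0, b1, b2, b3] \<and> (\<exists>a0 a1 a2 a3. distinct [a0, a1, a2, a3] \<and>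
      \<not> T b0 a0 b1 \<and> \<not> Q b0 a0 b1 a1 \<and> \<not> Q b1 a1 b2 a0 \<and> \<not> T b1 a1 b2 \<and> \<not> Q b1 a1 b2 a2 \<and>
      \<not> Q b2 a2 b3 a1 \<and> \<not> T b2 a2 b3 \<and> \<not> Q b2 a2 b3 a3)"
    proof (rule arrangement_idx)
      show "Q u a v b \<longleftrightarrow> Q v b u a" for u a v b unfolding Q_def by (rule rot)
      show "\<forall>u v. u \<noteq> v \<longrightarrow> (\<forall>a b b'. Q u a v b \<longrightarrow> Q u a v b' \<longrightarrow> b = b')"
        unfolding Q by (metis fe)
      show "\<forall>a b. a \<noteq> b \<longrightarrow> (\<forall>u v v'. Q u a v b \<longrightarrow> Q u a v' b \<longrightarrow> v = v')"
        unfolding Q by (metis closer_right_eq_iff fc(1) gc(1) ge)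
      show "\<forall>u v a a'. T u a v \<longrightarrow> T u a' v \<longrightarrow> a = a'"
        unfolding T by (metis fe)
      show "\<forall>u a v v'. T u a v \<longrightarrow> T u a v' \<longrightarrow> v = v'"
        unfolding T by (metis closer_left_eq_iff one_closed gc(1) ge)
      show "\<forall>v a u u'. T u a v \<longrightarrow> T u' a v \<longrightarrow> u = u'"
        unfolding T by (metis closer_right_eq_iff one_closed gc(1) ge)
      show "\<forall>u v. u \<noteq> v \<longrightarrow> (\<forall>a b. a \<noteq> b \<longrightarrow> \<not> T u a v \<or> \<not> Q u a v b)"
        unfolding T_def Q_def by simp
      show "\<forall>b. \<not> Q I0 I0 I1 b" unfolding Q f(3) g(3,4) using a(2) f(2) by (metis insertCI rangeI)
      have "T I0 I0 I1 \<Longrightarrow> u \<otimes> a \<otimes> v = \<one>" unfolding T_def f(3) g(3,4) .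
      then have "T I0 I0 I1 \<Longrightarrow> closer u v a = \<one>" unfolding closer_def by simp
      then show "\<not> T I0 I0 I1" using a(2) by auto
    qed
    then show thesis using that by blast
  qed
  have all: "{i, j, k, l} = UNIV" if "distinct [i, j, k, l]" for i j k l :: idx
  proof (rule card_subset_eq)
    show "card {i, j, k, l} = card (UNIV :: idx set)" using that by (simp add: UNIV_idx)
    show "finite (UNIV :: idx set)" by (simp add: UNIV_idx)
  qed simp
  have "A = f ` {a0, a1, a2, a3}" "B = g ` {b0, b1, b2, b3}"
    unfolding all[OF dist(1)] all[OF dist(2)] using f(2) g(2) by simp_all
  then have AB: "A = {f a0, f a1, f a2, f a3}" "B = {g b0, g b1, g b2, g b3}" by simp_all
  have ne: "g i \<noteq> f j" for i j using fc(2) gc(2) by metis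
  let ?L = "[g b0, f a0, g b1, f a1, g b2, f a2, g b3, f a3]"
  have "good ?L"
    using ok by (simp add: odd_triple rot' flip: T_def Q_def)
  moreover have "distinct ?L" using dist ne by (simp add: fe ge ne[symmetric])
  ultimately have "seq ?L" unfolding seq_def by simp
  moreover have "set ?L = A \<union> B" unfolding AB by auto
  ultimately show ?thesis by blast
qed

end

text \<open>\<open>S\<close> is stable under all powers of \<open>g\<close>, hence a disjoint union
  of right cosets of the subgroup generated by \<open>g\<close>.\<close>

lemma (in group) ord_dvd_card:
  assumes S: "S \<subseteq> carrier G" "finite S" and g: "g \<in> carrier G" "ord g \<noteq> 0"
    and closed: "\<And>x. x \<in> S \<Longrightarrow> g \<otimes> x \<in> S"
  shows "ord g dvd card S"
proof -
  define H where "H = generate G {g}"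
  have H: "subgroup H G" "card H = ord g" "H = {g [^] k | k. k \<in> (UNIV :: nat set)}"
    unfolding H_def using g generate_is_subgroup[of "{g}"] generate_pow_card[OF g(1)] generate_pow_nat[OF g] by auto
  have "g [^] k \<otimes> x \<in> S" if "x \<in> S" for k :: nat and x
    using that
  proof (induction k arbitrary: x)
    case (Suc k)
    have "g [^] Suc k \<otimes> x = g [^] k \<otimes> (g \<otimes> x)" using g S Suc.prems by (simp add: m_assoc subset_iff)
    then show ?case using Suc closed by simp
  qed (use S in auto)
  then have "(\<Union>x\<in>S. H #> x) \<subseteq> S" unfolding H(3) r_coset_def by blast
  moreover have "x \<in> H #> x" if "x \<in> S" for x using that S H(1) rcos_self by blast
  ultimately have Un: "\<Union>((\<lambda>x. H #> x) ` S) = S" by blast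
  have sub: "(\<lambda>x. H #> x) ` S \<subseteq> rcosets H" using S unfolding RCOSETS_def by blast
  have "card H * card ((\<lambda>x. H #> x) ` S) = card (\<Union>((\<lambda>x. H #> x) ` S))"
  proof (rule card_partition)
    show "c1 \<inter> c2 = {}" if "c1 \<in> (\<lambda>x. H #> x) ` S" "c2 \<in> (\<lambda>x. H #> x) ` S" "c1 \<noteq> c2" for c1 c2
      using that sub rcos_disjoint[OF H(1)] unfolding pairwise_def disjnt_def by blast
    show "card c = card H" if "c \<in> (\<lambda>x. H #> x) ` S" for c
      using that sub card_rcosets_equal[of c H] subgroup.subset[OF H(1)] by auto
  qed (use S Un in auto)
  then show ?thesis unfolding Un H(2) by (metis dvd_triv_left)
qed

section \<open>The exceptional configuration of order five\<close>

context parity_group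
begin

text \<open>Every product of elements \<open>g [^] i\<close> and \<open>g [^] i \<otimes> t\<close>
  reduces to a sum of exponents modulo \<open>5\<close>, so explicit orderings can be checked by
  calculation.\<close>

lemma seq_cyclic_5:
  fixes k m :: nat
  assumes g: "g \<in> carrier G" "\<not> odd_el g" "ord g = 5" and t: "t \<in> carrier G" "odd_el t"
    and tg: "t \<otimes> g = g [^] k \<otimes> t" and tt: "t \<otimes> t = g [^] m"
    and km: "k = 1 \<and> m < 5 \<or> k = 4 \<and> m = 0"
  shows "\<exists>ys. seq ys \<and> set ys = (\<lambda>i. g [^] i) ` {1..4::nat} \<union> (\<lambda>i. g [^] i \<otimes> t) ` {1..4::nat}"
proof -
  define e where "e i = g [^] (i :: nat)" for i
  define u where "u i = e i \<otimes> t" for i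
  have carr: "e i \<in> carrier G" "u i \<in> carrier G" for i
    using g t unfolding u_def e_def by auto
  have par: "\<not> odd_el (e i)" for i
    unfolding e_def by (induction i) (use g odd_mult in auto)
  then have par': "odd_el (u i)" for i
    using carr t unfolding u_def by (simp add: odd_mult)
  have ee: "e i \<otimes> e j = e (i + j)" for i j using g unfolding e_def by (simp add: nat_pow_mult)
  have eu: "e i \<otimes> u j = u (i + j)" for i j
    unfolding u_def ee[symmetric] using carr t by (simp add: m_assoc)
  have te: "t \<otimes> e j = u (k * j)" for j
  proof (induction j)
    case (Suc j)
    have "t \<otimes> e (Suc j) = (t \<otimes> e j) \<otimes> g" unfolding e_def using g t by (simp add: m_assoc)
    also have "\<dots> = e (k * j) \<otimes> (t \<otimes> g)" unfolding Suc u_def using carr g t by (simp add: m_assoc)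
    also have "\<dots> = e (k * j) \<otimes> u k" unfolding tg u_def e_def ..
    also have "\<dots> = u (k * Suc j)" unfolding eu by (simp add: add.commute)
    finally show ?case .
  qed (use t in \<open>simp add: u_def e_def\<close>)
  have ue: "u i \<otimes> e j = u (i + k * j)" for i j
    using te[of j] eu[of i "k * j"] carr t unfolding u_def by (simp add: m_assoc)
  have uu: "u i \<otimes> u j = e (i + k * j + m)" for i j
  proof -
    have "u i \<otimes> u j = (u i \<otimes> e j) \<otimes> t" unfolding u_def[of j] using carr t by (simp add: m_assoc)
    also have "\<dots> = e (i + k * j) \<otimes> (t \<otimes> t)" unfolding ue unfolding u_def using carr t by (simp add: m_assoc)
    also have "\<dots> = e (i + k * j + m)" unfolding tt using ee unfolding e_def by simp
    finally show ?thesis .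
  qed
  have e1: "e i = \<one> \<longleftrightarrow> 5 dvd i" for i
    unfolding e_def using pow_eq_id[OF g(1), of i] g(3) by simp
  have u1: "u i \<noteq> \<one>" for i using par'[of i] by auto
  have inj: "inj_on e {1..4}"
    using ord_inj[OF g(1)] unfolding g(3) e_def inj_on_def by auto
  then have inju: "inj_on u {1..4}"
    using carr t unfolding inj_on_def u_def by (metis right_cancel)
  have ne: "e i \<noteq> u j" for i j using par par' by metis
  then have ne': "u j \<noteq> e i" for i j by metis
  define L where "L a1 a2 a3 a4 b1 b2 b3 b4 = [u b1, e a1, u b2, e a2, u b3, e a3, u b4, e a4]" for a1 a2 a3 a4 b1 b2 b3 b4
  have L: "\<exists>ys. seq ys \<and> set ys = e ` {1..4} \<union> u ` {1..4}"
    if "good (L a1 a2 a3 a4 b1 b2 b3 b4)" "{1..4} = {a1, a2, a3, a4}" "{1..4} = {b1, b2, b3, b4}"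
      "distinct [a1, a2, a3, a4]" "distinct [b1, b2, b3, b4]" for a1 a2 a3 a4 b1 b2 b3 b4
  proof -
    have mem: "a1 \<in> {1..4}" "a2 \<in> {1..4}" "a3 \<in> {1..4}" "a4 \<in> {1..4}"
      "b1 \<in> {1..4}" "b2 \<in> {1..4}" "b3 \<in> {1..4}" "b4 \<in> {1..4}" using that(2,3) by blast+
    have dist: "distinct (L a1 a2 a3 a4 b1 b2 b3 b4)"
      using that(4,5) inj_on_eq_iff[OF inj] inj_on_eq_iff[OF inju] mem unfolding L_def by (simp add: ne ne')
    moreover have "e ` {1..4} = {e a1, e a2, e a3, e a4}" unfolding that(2) by simp
    moreover have "u ` {1..4} = {u b1, u b2, u b3, u b4}" unfolding that(3) by simp
    ultimately have set: "set (L a1 a2 a3 a4 b1 b2 b3 b4) = e ` {1..4} \<union> u ` {1..4}"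
      unfolding L_def by auto
    moreover have "set (L a1 a2 a3 a4 b1 b2 b3 b4) \<subseteq> carrier G"
      "successively (\<lambda>x y. odd_el x \<noteq> odd_el y) (L a1 a2 a3 a4 b1 b2 b3 b4)"
      using carr par par' by (simp_all add: L_def)
    ultimately show ?thesis using that(1) dist set unfolding seq_def by blast
  qed
  have S: "{1..4::nat} = {1, 2, 3, 4}" by auto
  have S3: "{1..4::nat} = {3, 2, 4, 1}" "{1..4::nat} = {1, 2, 4, 3}" "{1..4::nat} = {2, 3, 4, 1}"
    "{1..4::nat} = {1, 4, 3, 2}" "{1..4::nat} = {3, 4, 2, 1}" "{1..4::nat} = {2, 1, 3, 4}"
    unfolding S by auto
  note calc = L_def ee eu ue uu e1 u1
  have "\<exists>ys. seq ys \<and> set ys = e ` {1..4} \<union> u ` {1..4}"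
  proof -
    \<comment> \<open>For \<open>k = 1\<close>, the exponents of the relevant windows modulo
      \<open>5\<close>, before \<open>m\<close> is added, lie in \<open>{1, 2, 3}\<close> for the
      first ordering, \<open>{0, 2, 4}\<close> for the second and \<open>{0, 1, 3, 4}\<close> for
      the third. The third also serves \<open>k = 4\<close>.\<close>
    consider "k = 1" "m = 0 \<or> m = 1" | "k = 1" "m = 2 \<or> m = 4" | "k = 1" "m = 3" | "k = 4" "m = 0"
      using km by linarith
    then show ?thesis
    proof cases
      case 1
      then have "good (L 3 2 4 1 1 2 4 3)" by (auto simp: calc)
      then show ?thesis by (rule L[OF _ S3(1,2)]) simp_all
    next
      case 2
      then have "good (L 2 3 4 1 1 4 3 2)" by (auto simp: calc)
      then show ?thesis by (rule L[OF _ S3(3,4)]) simp_all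
    next
      case 3
      then have "good (L 3 4 2 1 2 1 3 4)" by (simp add: calc)
      then show ?thesis by (rule L[OF _ S3(5,6)]) simp_all
    next
      case 4
      then have "good (L 3 4 2 1 2 1 3 4)" by (simp add: calc)
      then show ?thesis by (rule L[OF _ S3(5,6)]) simp_all
    qed
  qed
  then show ?thesis unfolding e_def u_def .
qed

end

lemma (in group) mult_inv_cancel:
  assumes "x \<in> carrier G" "y \<in> carrier G"
  shows "inv x \<otimes> (x \<otimes> y) = y" "x \<otimes> (inv x \<otimes> y) = y"
  using assms by (simp_all flip: m_assoc)

section \<open>Four elements of each parity: the saturated case\<close>

context parity_group
begin

text \<open>If the two maps agree at \<open>x\<close> and \<open>y\<close>, cancelling
  \<open>v\<close> gives \<open>u \<otimes> x = w \<otimes> y\<close>: they differ by a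
  translation.\<close>

lemma closer_image_eq_imp:
  assumes "S \<subseteq> carrier G" "u \<in> carrier G" "v \<in> carrier G" "w \<in> carrier G"
    and eq: "closer u v ` S = closer w v ` S" and x: "x \<in> S"
  shows "inv w \<otimes> u \<otimes> x \<in> S"
proof -
  obtain y where y: "y \<in> S" "closer u v x = closer w v y" using eq x by blast
  have xy: "x \<in> carrier G" "y \<in> carrier G" using x y assms(1) by auto
  then have "u \<otimes> x \<otimes> v = w \<otimes> y \<otimes> v"
    using y(2) assms unfolding closer_def by (metis inv_inv m_closed)
  then have "u \<otimes> x = w \<otimes> y" using xy assms by simp
  then have "inv w \<otimes> u \<otimes> x = y" using xy assms by (simp add: m_assoc mult_inv_cancel)
  then show ?thesis using y by simp
qed

lemma not_odd_inv_mult: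
  assumes "u \<in> carrier G" "w \<in> carrier G" "odd_el u" "odd_el w"
  shows "\<not> odd_el (inv w \<otimes> u)"
  using assms odd_mult[of w "inv w"] odd_mult[of "inv w" u] by simp

lemma ord_dvd_card_if_closer_image_eq:
  assumes "S \<subseteq> carrier G" "finite S" "u \<in> carrier G" "v \<in> carrier G" "w \<in> carrier G" "odd_el u" "odd_el w"
    and "closer u v ` S = closer w v ` S"
  shows "ord (inv w \<otimes> u) dvd card S" "odd (ord (inv w \<otimes> u))"
proof -
  show odd: "odd (ord (inv w \<otimes> u))" using odd_ord not_odd_inv_mult assms by simp
  \<comment> \<open>Being odd, the order is not the value \<open>0\<close> that stands for infinite
    order, so cosets can be counted.\<close>
  then have "ord (inv w \<otimes> u) \<noteq> 0" by presburger
  then show "ord (inv w \<otimes> u) dvd card S"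
    using ord_dvd_card[OF assms(1,2)] closer_image_eq_imp[of S u v w] assms by simp
qed

lemma seq_saturated_4:
  assumes A: "A \<subseteq> carrier G" "\<one> \<notin> A" "card A = 4"
    and B: "B \<subseteq> carrier G" "\<forall>y \<in> B. odd_el y" "card B = 4"
    and sat: "\<And>u v a. u \<in> B \<Longrightarrow> v \<in> B \<Longrightarrow> u \<noteq> v \<Longrightarrow> a \<in> A \<Longrightarrow> closer u v a \<in> insert \<one> A"
  shows "\<exists>ys. seq ys \<and> set ys = A \<union> B"
proof -
  define C where "C = insert \<one> A"
  have fin: "finite A" "finite C" "finite B" using A(3) B(3) card.infinite unfolding C_def by fastforce+
  have C: "C \<subseteq> carrier G" "card C = 5" "\<one> \<in> C" "A = C - {\<one>}" using A fin unfolding C_def by auto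
  have Bc: "u \<in> carrier G" "odd_el u" if "u \<in> B" for u using B that by auto
  \<comment> \<open>If the image of \<open>A\<close> omits \<open>\<one>\<close>, it is
    \<open>A\<close>. Otherwise it omits exactly one \<open>f\<close> in \<open>A\<close>, and
    saturation for the reversed pair shows that \<open>\<one>\<close> is sent to
    \<open>f\<close>.\<close>
  have kind: "closer u v ` A = A \<or> closer u v ` C = C" if "u \<in> B" "v \<in> B" "u \<noteq> v" for u v
  proof -
    define I where "I = closer u v ` A"
    have "inj_on (closer u v) A"
      using A(1) Bc that by (intro inj_onI) (simp add: closer_eq_iff subset_iff)
    then have cardI: "card I = 4" unfolding I_def using A(3) by (simp add: card_image)
    have IC: "I \<subseteq> C" using sat[OF that] unfolding I_def C_def by blast
    show ?thesis
    proof (cases "\<one> \<in> I")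
      case False
      then have "I \<subseteq> A" using IC unfolding C_def by blast
      then have "I = A" using cardI A(3) fin by (simp add: card_subset_eq)
      then show ?thesis unfolding I_def by blast
    next
      case True
      have "card (C - I) = 1" using IC C(2) cardI fin by (simp add: card_Diff_subset finite_subset)
      then obtain f where f: "C - I = {f}" by (rule card_1_singletonE)
      then have fA: "f \<in> A" "f \<notin> I" using True unfolding C_def by auto
      then have fc: "f \<in> carrier G" using A by auto
      have cancel: "closer u v (closer v u f) = f" using closer_closer[of v u f] Bc that fc by simp
      then have "closer v u f \<notin> A" using fA unfolding I_def by force
      then have "closer v u f = \<one>" using sat[of v u f] that fA by auto
      then have "closer u v \<one> = f" using cancel by simp
      then have "closer u v ` C = insert f I" unfolding C_def I_def by simp
      also have "\<dots> = C" using f IC by auto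
      finally show ?thesis by simp
    qed
  qed
  \<comment> \<open>At most one of the three maps permutes \<open>A\<close>: for two of them, the
    quotient would have odd order dividing four.\<close>
  have two: "\<exists>u w. u \<in> B \<and> w \<in> B \<and> u \<noteq> v \<and> w \<noteq> v \<and> u \<noteq> w \<and> closer u v ` C = C \<and> closer w v ` C = C"
    if v: "v \<in> B" for v
  proof -
    have "card (B - {v}) = 3" using B(3) v fin by simp
    then obtain x y z where xyz: "B - {v} = {x, y, z}" "x \<noteq> y" "x \<noteq> z" "y \<noteq> z" unfolding card_3_iff by auto
    have mem: "x \<in> B" "y \<in> B" "z \<in> B" "x \<noteq> v" "y \<noteq> v" "z \<noteq> v" using xyz(1) by auto
    have one: "u = w" if "u \<in> B" "w \<in> B" "closer u v ` A = A" "closer w v ` A = A" for u w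
    proof -
      have "ord (inv w \<otimes> u) dvd 4" "odd (ord (inv w \<otimes> u))"
        using ord_dvd_card_if_closer_image_eq[of A u v w] that v Bc A fin by auto
      moreover have "(4::nat) = 2 ^ 2" by simp
      ultimately have "ord (inv w \<otimes> u) dvd 1"
        by (metis coprime_dvd_mult_left_iff coprime_right_2_iff_odd coprime_power_right_iff mult_1 nat_mult_1_right)
      then have "inv w \<otimes> u = \<one>" using ord_eq_1[of "inv w \<otimes> u"] Bc that by simp
      then show "u = w" using Bc that by (metis inv_closed inv_equality inv_inv)
    qed
    show ?thesis
      using kind[of x v] kind[of y v] kind[of z v] one[of x y] one[of x z] one[of y z] xyz(2-4) mem v by metis
  qed
  obtain v where "v \<in> B" using B(3) by fastforce
  then obtain u w where uw: "u \<in> B" "w \<in> B" "u \<noteq> w" "closer u v ` C = C" "closer w v ` C = C"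
    using two by blast
  define g where "g = inv w \<otimes> u"
  have gc: "g \<in> carrier G" unfolding g_def using Bc uw by simp
  have "g \<noteq> \<one>" unfolding g_def using uw Bc by (metis inv_closed inv_equality inv_inv)
  have "ord g dvd 5"
    using ord_dvd_card_if_closer_image_eq(1)[of C u v w] uw \<open>v \<in> B\<close> Bc C fin unfolding g_def by simp
  moreover have "prime (5::nat)" by simp
  ultimately have ordg: "ord g = 5"
    using \<open>g \<noteq> \<one>\<close> gc ord_eq_1 prime_nat_iff by metis
  have go: "\<not> odd_el g" unfolding g_def using not_odd_inv_mult Bc uw by simp
  have gC: "g \<otimes> x \<in> C" if "x \<in> C" for x
    unfolding g_def using closer_image_eq_imp[of C u v w x] that uw \<open>v \<in> B\<close> Bc C(1) by simp
  have "g [^] (k :: nat) \<in> C" for k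
  proof (induction k)
    case (Suc k)
    then show ?case using gC[OF Suc] gc by (metis nat_pow_Suc2)
  qed (use C in simp)
  moreover have gen: "generate G {g} = {g [^] k | k. k \<in> (UNIV :: nat set)}"
    using generate_pow_nat[OF gc] ordg by simp
  ultimately have "generate G {g} \<subseteq> C" by auto
  then have CH: "C = generate G {g}"
    using generate_pow_card[OF gc] ordg C(2) fin by (metis card_subset_eq)
  interpret C: subgroup C G unfolding CH using generate_is_subgroup gc by simp
  have closerC: "u \<otimes> x \<otimes> v \<in> C" if "closer u v x \<in> C" "u \<in> carrier G" "v \<in> carrier G" "x \<in> carrier G" for u v x
    using C.m_inv_closed[OF that(1)] that unfolding closer_def by simp
  \<comment> \<open>Both \<open>u \<otimes> b\<close> and \<open>u \<otimes> x \<otimes> b\<close>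
    lie in the subgroup \<open>C\<close>, and \<open>u\<close> cancels in their quotient.\<close>
  have conj: "inv b \<otimes> x \<otimes> b \<in> C" if b: "b \<in> B" and x: "x \<in> C" for b x
  proof -
    obtain u where u: "u \<in> B" "closer u b ` C = C" using two[OF b] by blast
    have c: "b \<in> carrier G" "u \<in> carrier G" "x \<in> carrier G" using u b x Bc C by auto
    have "u \<otimes> \<one> \<otimes> b \<in> C" "u \<otimes> x \<otimes> b \<in> C" using closerC u(2) x C(3) c by blast+
    then have "inv (u \<otimes> b) \<otimes> (u \<otimes> x \<otimes> b) \<in> C" using c by simp
    moreover have "inv (u \<otimes> b) \<otimes> (u \<otimes> x \<otimes> b) = inv b \<otimes> x \<otimes> b"
      using c by (simp add: inv_mult_group m_assoc mult_inv_cancel)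
    ultimately show ?thesis by simp
  qed
  \<comment> \<open>The middle factor of \<open>u \<otimes> a \<otimes> v\<close> is removed by a
    conjugate of \<open>inv a\<close>, which \<open>conj\<close> puts into \<open>C\<close>.\<close>
  have prod: "u \<otimes> v \<in> C" if uv: "u \<in> B" "v \<in> B" "u \<noteq> v" for u v
  proof -
    obtain a where a: "a \<in> A" using A(3) by fastforce
    then have aC: "a \<in> C" "inv a \<in> C" unfolding C_def[symmetric] using C by auto
    have c: "u \<in> carrier G" "v \<in> carrier G" "a \<in> carrier G" using uv a Bc A by auto
    have "u \<otimes> a \<otimes> v \<in> C" using closerC sat[OF uv a] c unfolding C_def by blast
    then have "(u \<otimes> a \<otimes> v) \<otimes> (inv v \<otimes> inv a \<otimes> v) \<in> C" using conj[OF uv(2) aC(2)] by simp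
    moreover have "(u \<otimes> a \<otimes> v) \<otimes> (inv v \<otimes> inv a \<otimes> v) = u \<otimes> v"
      using c by (simp add: m_assoc mult_inv_cancel)
    ultimately show ?thesis by simp
  qed
  obtain b where b: "b \<in> B" using B(3) by fastforce
  have bc: "b \<in> carrier G" using b Bc by simp
  have coset: "v \<otimes> inv b \<in> C" if v: "v \<in> B" for v
  proof (cases "v = b")
    case False
    have "\<not> B \<subseteq> {v, b}" using B(3) card_mono[of "{v, b}" B] card_insert_le_m1[of 2 "{b}" v] by auto
    then obtain w where w: "w \<in> B" "w \<noteq> v" "w \<noteq> b" by blast
    have c: "v \<in> carrier G" "w \<in> carrier G" using v w Bc by auto
    have "(v \<otimes> w) \<otimes> inv (b \<otimes> w) \<in> C" using prod[of v w] prod[of b w] v w b by simp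
    moreover have "(v \<otimes> w) \<otimes> inv (b \<otimes> w) = v \<otimes> inv b"
      using c bc by (simp add: inv_mult_group m_assoc mult_inv_cancel)
    ultimately show ?thesis by simp
  qed (use b Bc C in simp)
  have inB: "\<exists>h\<in>C. v = h \<otimes> b" if "v \<in> B" for v
    using coset[OF that] that Bc bc by (intro bexI[of _ "v \<otimes> inv b"]) (simp_all add: m_assoc)
  have bb: "b \<otimes> b \<in> C"
  proof -
    have "\<not> B \<subseteq> {b}" using B(3) card_mono[of "{b}" B] by auto
    then obtain v where v: "v \<in> B" "v \<noteq> b" by blast
    then obtain h where h: "h \<in> C" "v = h \<otimes> b" using inB by blast
    have "inv h \<otimes> (v \<otimes> b) \<in> C" using prod[of v b] v b h(1) by simp
    moreover have "inv h \<otimes> (v \<otimes> b) = b \<otimes> b" using h C(1) bc by (auto simp: m_assoc subset_iff mult_inv_cancel)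
    ultimately show ?thesis by simp
  qed
  have conj': "b \<otimes> x \<otimes> inv b \<in> C" if x: "x \<in> C" for x
  proof -
    have c: "x \<in> carrier G" using x C by auto
    have "(b \<otimes> b) \<otimes> (inv b \<otimes> x \<otimes> b) \<otimes> inv (b \<otimes> b) \<in> C" using bb conj[OF b x] by simp
    moreover have "(b \<otimes> b) \<otimes> (inv b \<otimes> x \<otimes> b) \<otimes> inv (b \<otimes> b) = b \<otimes> x \<otimes> inv b"
      using c bc by (simp add: inv_mult_group m_assoc mult_inv_cancel)
    ultimately show ?thesis by simp
  qed
  define K where "K = (\<lambda>h. h \<otimes> b) ` C"
  have "inj_on (\<lambda>h. h \<otimes> b) C" using C(1) bc by (intro inj_onI) (simp add: subset_iff)
  then have "card K = 5" unfolding K_def using C(2) by (simp add: card_image)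
  moreover have BK: "B \<subseteq> K" using inB unfolding K_def by blast
  \<comment> \<open>\<open>B\<close> misses one element \<open>t\<close> of its coset. With
    \<open>t\<close> as representative, \<open>B\<close> consists of the products of
    \<open>t\<close> with the nontrivial elements of \<open>C\<close>.\<close>
  ultimately have "card (K - B) = 1" using B(3) fin by (simp add: card_Diff_subset)
  then obtain t where t: "K - B = {t}" by (rule card_1_singletonE)
  then have Bt: "B = K - {t}" "t \<in> K" using BK by auto
  then obtain h where h: "h \<in> C" "t = h \<otimes> b" unfolding K_def by blast
  have hc: "h \<in> carrier G" using h C by auto
  have tc: "t \<in> carrier G" using h hc bc by simp
  have todd: "odd_el t"
  proof -
    have "\<not> odd_el x" if "x \<in> C" for x
    proof -
      from that obtain k :: nat where "x = g [^] k" unfolding CH gen by blast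
      moreover have "\<not> odd_el (g [^] k)" for k :: nat by (induction k) (use go gc odd_mult in auto)
      ultimately show ?thesis by simp
    qed
    then show ?thesis using h odd_mult[OF hc bc] Bc(2)[OF b] by simp
  qed
  have conjt: "t \<otimes> x \<otimes> inv t \<in> C" if x: "x \<in> C" for x
  proof -
    have "h \<otimes> (b \<otimes> x \<otimes> inv b) \<otimes> inv h \<in> C" using h(1) conj'[OF x] by simp
    then show ?thesis using x C(1) hc bc unfolding h(2) by (simp add: inv_mult_group m_assoc subset_iff)
  qed
  have tt: "t \<otimes> t \<in> C"
  proof -
    have "h \<otimes> (b \<otimes> h \<otimes> inv b) \<otimes> (b \<otimes> b) \<in> C" using h(1) conj' bb by simp
    moreover have "h \<otimes> (b \<otimes> h \<otimes> inv b) \<otimes> (b \<otimes> b) = t \<otimes> t"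
      using hc bc unfolding h(2) by (simp add: m_assoc mult_inv_cancel)
    ultimately show ?thesis by simp
  qed
  have mod: "g [^] n = g [^] (n mod 5)" for n :: nat
    using pow_eq_id[OF gc, of "5 * (n div 5)"] ordg gc
    by (metis dvd_triv_left l_one mult_div_mod_eq nat_pow_closed nat_pow_mult)
  have inj: "i = j" if "g [^] i = g [^] j" "i < 5" "j < 5" for i j :: nat
    using ord_inj[OF gc] that unfolding ordg inj_on_def by auto
  have pow: "\<exists>k::nat. k < 5 \<and> x = g [^] k" if x: "x \<in> C" for x
  proof -
    from x obtain k :: nat where "x = g [^] k" unfolding CH gen by blast
    then show ?thesis using mod[of k] by (intro exI[of _ "k mod 5"]) simp
  qed
  have powC: "g [^] k \<in> C" for k :: nat unfolding CH gen by blast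
  obtain k :: nat where k: "k < 5" "t \<otimes> g \<otimes> inv t = g [^] k" using pow[OF conjt[of g]] powC[of 1] gc by auto
  obtain m :: nat where m: "m < 5" "t \<otimes> t = g [^] m" using pow[OF tt] by blast
  have tg: "t \<otimes> g = g [^] k \<otimes> t" using k(2) tc gc by (metis inv_solve_right m_closed nat_pow_closed)
  have tgj: "t \<otimes> g [^] j = g [^] (k * j) \<otimes> t" for j :: nat
  proof (induction j)
    case (Suc j)
    have "t \<otimes> g [^] Suc j = (t \<otimes> g [^] j) \<otimes> g" using gc tc by (simp add: m_assoc)
    also have "\<dots> = g [^] (k * j) \<otimes> (t \<otimes> g)" unfolding Suc using gc tc by (simp add: m_assoc)
    also have "\<dots> = g [^] (k * j) \<otimes> g [^] k \<otimes> t" unfolding tg using gc tc by (simp add: m_assoc)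
    also have "\<dots> = g [^] (k * Suc j) \<otimes> t" using gc by (simp add: nat_pow_mult add.commute)
    finally show ?case .
  qed (use tc in simp)
  \<comment> \<open>As \<open>t \<otimes> t\<close> is a power of \<open>g\<close>, it commutes with
    \<open>g\<close>; hence \<open>k * k\<close> is \<open>1\<close> modulo
    \<open>5\<close>.\<close>
  have "t \<otimes> t \<otimes> g = t \<otimes> (g [^] k \<otimes> t)" using tc gc tg by (simp add: m_assoc)
  also have "\<dots> = (t \<otimes> g [^] k) \<otimes> t" using tc gc by (simp add: m_assoc)
  also have "\<dots> = g [^] (k * k) \<otimes> (t \<otimes> t)" unfolding tgj using tc gc by (simp add: m_assoc)
  finally have "g [^] m \<otimes> g = g [^] (k * k) \<otimes> g [^] m" unfolding m(2) .
  then have "g [^] (m + 1) = g [^] (m + k * k)" using gc by (simp add: nat_pow_mult add.commute)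
  then have "g [^] m \<otimes> g [^] (1::nat) = g [^] m \<otimes> g [^] (k * k)" using gc by (simp add: nat_pow_mult)
  then have "g [^] (1::nat) = g [^] (k * k)" using gc by (metis Units_eq Units_l_cancel nat_pow_closed)
  then have "g [^] (1::nat) = g [^] ((k * k) mod 5)" using mod[of "k * k"] by (rule trans)
  then have "(k * k) mod 5 = 1" using inj[of 1 "(k * k) mod 5"] by simp
  moreover have "k = 0 \<or> k = 1 \<or> k = 2 \<or> k = 3 \<or> k = 4" using k(1) by linarith
  ultimately have k14: "k = 1 \<or> k = 4" by auto
  \<comment> \<open>\<open>t\<close> commutes with its own square \<open>g [^] m\<close>.\<close>
  have "g [^] (k * m) \<otimes> t = g [^] m \<otimes> t" using tgj[of m] m(2) tc by (metis m_assoc)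
  then have "g [^] (k * m) = g [^] m" using gc tc by (metis nat_pow_closed right_cancel)
  then have "(k * m) mod 5 = m" using inj[of "(k * m) mod 5" m] mod[of "k * m"] m(1) by simp
  moreover have "m = 0 \<or> m = 1 \<or> m = 2 \<or> m = 3 \<or> m = 4" using m(1) by linarith
  ultimately have km: "k = 1 \<and> m < 5 \<or> k = 4 \<and> m = 0" using k14 m(1) by auto
  have S: "{1..4::nat} = {..<5} - {0}" by auto
  have Cpow: "C = (\<lambda>i. g [^] i) ` {..<5::nat}" using pow powC by auto
  have injg: "inj_on (\<lambda>i. g [^] i) {..<5::nat}" using inj by (auto intro!: inj_onI)
  have "inj_on (\<lambda>i. g [^] i \<otimes> t) {..<5::nat}"
    using inj gc tc by (auto intro!: inj_onI)
  then have "(\<lambda>i. g [^] i \<otimes> t) ` {1..4::nat} = (\<lambda>i. g [^] i \<otimes> t) ` {..<5::nat} - {t}"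
    unfolding S using tc by (subst inj_on_image_set_diff) auto
  also have "(\<lambda>i. g [^] i \<otimes> t) ` {..<5::nat} = (\<lambda>x. x \<otimes> t) ` C" unfolding Cpow by (simp add: image_image)
  also have "(\<lambda>x. x \<otimes> t) ` C = K"
  proof (intro equalityI subsetI)
    fix y assume "y \<in> (\<lambda>x. x \<otimes> t) ` C"
    then obtain x where "x \<in> C" "y = x \<otimes> t" by blast
    then have "y = (x \<otimes> h) \<otimes> b" "x \<otimes> h \<in> C" using h hc bc C(1) by (auto simp: m_assoc subset_iff)
    then show "y \<in> K" unfolding K_def by blast
  next
    fix y assume "y \<in> K"
    then obtain x where x: "x \<in> C" "y = x \<otimes> b" unfolding K_def by blast
    then have "y = (x \<otimes> inv h) \<otimes> t" using h hc bc C(1) by (auto simp: m_assoc subset_iff mult_inv_cancel)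
    moreover have "x \<otimes> inv h \<in> C" using x h by simp
    ultimately show "y \<in> (\<lambda>x. x \<otimes> t) ` C" by blast
  qed
  finally have Bpow: "(\<lambda>i. g [^] i \<otimes> t) ` {1..4::nat} = B" using Bt(1) by simp
  have Apow: "(\<lambda>i. g [^] i) ` {1..4::nat} = A"
    unfolding C(4) Cpow S using injg by (subst inj_on_image_set_diff) auto
  show ?thesis using seq_cyclic_5[OF gc go ordg tc todd tg m(2) km] unfolding Apow Bpow .
qed

end

section \<open>The semidirect product\<close>

lemma (in monoid) good_nth:
  assumes "good ys"
  shows "i + 2 < length ys \<Longrightarrow> ys ! i \<otimes> ys ! (i + 1) \<otimes> ys ! (i + 2) \<noteq> \<one>"
    and "i + 3 < length ys \<Longrightarrow> ys ! i \<otimes> ys ! (i + 1) \<otimes> ys ! (i + 2) \<otimes> ys ! (i + 3) \<noteq> \<one>"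
  using assms
proof (induction ys arbitrary: i rule: good.induct)
  case (1 w x y z ys)
  { case 1
    then show ?case using "1.IH"(1)[of "i - 1"] by (cases i) (auto simp: eval_nat_numeral) }
  { case 2
    then show ?case using "1.IH"(2)[of "i - 1"] by (cases i) (auto simp: eval_nat_numeral) }
qed (auto simp: eval_nat_numeral)

section \<open>From products of windows to partial sums\<close>

context parity_group
begin

text \<open>By left cancellation, equal partial sums at \<open>i < j\<close> give a window of length
  \<open>j - i\<close> with product \<open>\<one>\<close>. Length one is excluded by the absence of
  \<open>\<one>\<close>, two by parity, three and four by \<open>good\<close>.\<close>

lemma seq_imp_weak_sequencing:
  assumes "seq ys" "\<one> \<notin> set ys"
  shows "weak_sequencing G 4 (set ys) ys"
proof -
  have ys: "set ys \<subseteq> carrier G" "distinct ys" "good ys" and alt: "successively (\<lambda>x y. odd_el x \<noteq> odd_el y) ys"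
    using assms(1) unfolding seq_def by auto
  have carr: "ys ! i \<in> carrier G" if "i < length ys" for i using that ys(1) by auto
  have P_carr: "foldl (\<otimes>) \<one> zs \<in> carrier G" if "set zs \<subseteq> carrier G" for zs
    using that by (induction zs rule: rev_induct) auto
  define P where "P = partial_sum G ys"
  have Pc: "P i \<in> carrier G" for i
    unfolding P_def partial_sum_def using P_carr set_take_subset ys(1) by (metis subset_trans)
  have Suc: "P (Suc i) = P i \<otimes> ys ! i" if "i < length ys" for i
    unfolding P_def partial_sum_def using that by (simp add: take_Suc_conv_app_nth)
  have ne: "P i \<noteq> P j" if ij: "i < j" "j \<le> i + 4" "j \<le> length ys" for i j
  proof
    assume eq: "P i = P j"
    consider "j = Suc i" | "j = Suc (Suc i)" | "j = Suc (Suc (Suc i))" | "j = Suc (Suc (Suc (Suc i)))"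
      using ij by linarith
    then show False
    proof cases
      case 1
      then have "ys ! i = \<one>" using eq Suc[of i] carr[of i] Pc[of i] ij by (simp add: eq_commute)
      then show False using assms(2) ij 1 by (metis Suc_le_lessD nth_mem)
    next
      case 2
      then have "ys ! i \<otimes> ys ! Suc i = \<one>"
        using eq Suc[of i] Suc[of "Suc i"] carr[of i] carr[of "Suc i"] Pc[of i] ij by (simp add: m_assoc)
      moreover have "odd_el (ys ! i) \<noteq> odd_el (ys ! Suc i)"
        using alt 2 ij by (simp add: successively_conv_nth)
      ultimately show False using odd_mult[of "ys ! i" "ys ! Suc i"] carr 2 ij by simp
    next
      case 3
      then have "ys ! i \<otimes> ys ! (i + 1) \<otimes> ys ! (i + 2) = \<one>"
        using eq Suc[of i] Suc[of "i + 1"] Suc[of "i + 2"] carr[of i] carr[of "i + 1"] carr[of "i + 2"] Pc[of i] ij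
        by (simp add: m_assoc)
      then show False using good_nth(1)[OF ys(3), of i] 3 ij by simp
    next
      case 4
      then have "ys ! i \<otimes> ys ! (i + 1) \<otimes> ys ! (i + 2) \<otimes> ys ! (i + 3) = \<one>"
        using eq Suc[of i] Suc[of "i + 1"] Suc[of "i + 2"] Suc[of "i + 3"]
          carr[of i] carr[of "i + 1"] carr[of "i + 2"] carr[of "i + 3"] Pc[of i] ij
        by (simp add: m_assoc eval_nat_numeral)
      then show False using good_nth(2)[OF ys(3), of i] 4 ij by simp
    qed
  qed
  show ?thesis unfolding weak_sequencing_def
  proof (intro conjI allI impI ys(2) refl)
    fix i j assume "i \<le> length ys" "j \<le> length ys" "1 \<le> \<bar>int i - int j\<bar> \<and> \<bar>int i - int j\<bar> \<le> int 4"
    then have "i < j \<and> j \<le> i + 4 \<or> j < i \<and> i \<le> j + 4" by linarith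
    then show "partial_sum G ys i \<noteq> partial_sum G ys j"
      using ne[of i j] ne[of j i] \<open>i \<le> length ys\<close> \<open>j \<le> length ys\<close> unfolding P_def by auto
  qed
qed

lemma seq_4:
  assumes "A \<subseteq> carrier G" "\<forall>x \<in> A. \<not> odd_el x" "\<one> \<notin> A" "card A = 4"
    and "B \<subseteq> carrier G" "\<forall>y \<in> B. odd_el y" "card B = 4"
  shows "\<exists>ys. seq ys \<and> set ys = A \<union> B"
  using seq_unsaturated_4[OF assms] seq_saturated_4[OF assms(1,3-7)] by blast

end

text \<open>As \<open>\<phi> 0\<close> is the identity on \<open>N\<close>, the powers of
  \<open>(y, 0)\<close> are those of \<open>y\<close>, so its order divides the odd number
  \<open>order N\<close>.\<close>

lemma parity_group_semidirect_Z2: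
  assumes N: "group N" "odd (order N)" and \<phi>: "\<phi> \<in> hom (integer_mod_group 2) (AutoGroup N)"
  shows "parity_group (semidirect_Z2 N \<phi>) odd_elt"
proof -
  let ?G = "semidirect_Z2 N \<phi>"
  interpret N: group N by (fact N(1))
  interpret G: group ?G using group_semidirect_product[OF N(1) group_integer_mod_group \<phi>] .
  interpret \<phi>: group_hom "integer_mod_group 2" "AutoGroup N" \<phi>
    using N.AutoGroup \<phi> by (simp add: group_hom_def group_hom_axioms_def)
  have one: "\<phi> 0 x = x" if "x \<in> carrier N" for x
    using \<phi>.hom_one that by (simp add: AutoGroup_def BijGroup_def)
  show ?thesis
  proof unfold_locales
    fix x y assume "x \<in> carrier ?G" "y \<in> carrier ?G"
    then have "snd x \<in> {0..<2}" "snd y \<in> {0..<2}" "snd (x \<otimes>\<^bsub>?G\<^esub> y) = (snd x + snd y) mod 2"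
      by (auto simp: semidirect_product_def carrier_integer_mod_group mult_integer_mod_group split: prod.splits)
    moreover from this have "snd x = 0 \<or> snd x = 1" "snd y = 0 \<or> snd y = 1" by auto
    ultimately show "odd_elt (x \<otimes>\<^bsub>?G\<^esub> y) \<longleftrightarrow> odd_elt x \<noteq> odd_elt y"
      unfolding odd_elt_def by auto
  next
    fix x assume x: "x \<in> carrier ?G" "\<not> odd_elt x"
    then obtain y where y: "y \<in> carrier N" "x = (y, 0)"
      by (cases x) (auto simp: semidirect_product_def carrier_integer_mod_group odd_elt_def)
    have "x [^]\<^bsub>?G\<^esub> n = (y [^]\<^bsub>N\<^esub> n, 0)" for n :: nat
    proof (induction n)
      case 0
      show ?case by (simp add: semidirect_product_def)
    next
      case (Suc n)
      then show ?case using y one by (simp add: semidirect_product_def mult_integer_mod_group)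
    qed
    then have "x [^]\<^bsub>?G\<^esub> order N = \<one>\<^bsub>?G\<^esub>"
      using N.pow_order_eq_1[OF y(1)] by (simp add: semidirect_product_def)
    then have "G.ord x dvd order N" using G.pow_eq_id[OF x(1)] by simp
    then show "odd (G.ord x)" using N(2) by (meson dvd_trans)
  qed
qed

theorem theorem4p5:
  fixes N :: "('a, 'c) monoid_scheme"
    and \<phi> :: "int \<Rightarrow> 'a \<Rightarrow> 'a"
    and k :: nat
    and S :: "('a \<times> int) set"
  assumes "group N" and "finite (carrier N)" and "odd (order N)"
    and "\<phi> \<in> hom (integer_mod_group 2) (AutoGroup N)"
    and "k > 0" and "[k = 8] (mod 10)"
    and "S \<subseteq> carrier (semidirect_Z2 N \<phi>) - {\<one>\<^bsub>semidirect_Z2 N \<phi>\<^esub>}"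
    and "has_type S (k div 2) (k div 2)"
  shows "\<exists>ys. weak_sequencing (semidirect_Z2 N \<phi>) 4 S ys \<and> alternating_parity ys"
proof -
  interpret parity_group "semidirect_Z2 N \<phi>" odd_elt
    using parity_group_semidirect_Z2 assms(1,3,4) .
  define A where "A = {g \<in> S. even_elt g}"
  define B where "B = {g \<in> S. odd_elt g}"
  have even_iff: "even_elt g \<longleftrightarrow> \<not> odd_elt g" if "g \<in> carrier (semidirect_Z2 N \<phi>)" for g
    using that by (cases g) (auto simp: semidirect_product_def carrier_integer_mod_group even_elt_def odd_elt_def)
  have S: "S = A \<union> B" using assms(7) even_iff unfolding A_def B_def by auto
  have A: "A \<subseteq> carrier (semidirect_Z2 N \<phi>)" "\<forall>x \<in> A. \<not> odd_elt x" "\<one>\<^bsub>semidirect_Z2 N \<phi>\<^esub> \<notin> A"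
    and B: "B \<subseteq> carrier (semidirect_Z2 N \<phi>)" "\<forall>y \<in> B. odd_elt y"
    using assms(7) even_iff unfolding A_def B_def by auto
  have card: "card A = k div 2" "card B = k div 2" using assms(8) unfolding has_type_def A_def B_def by auto
  have "k mod 10 = 8" using assms(6) by (simp add: cong_def)
  \<comment> \<open>\<open>k div 2\<close> is \<open>4\<close> modulo \<open>5\<close>, so the
    values after \<open>4\<close> start at \<open>9\<close>.\<close>
  then have "k div 2 = 4 \<or> k div 2 \<ge> 9" by presburger
  then have "\<exists>ys. seq ys \<and> set ys = A \<union> B"
    using seq_4[OF A _ B] seq_large[OF A B card] card by auto
  then obtain ys where ys: "seq ys" "set ys = S" unfolding S by blast
  have "weak_sequencing (semidirect_Z2 N \<phi>) 4 S ys"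
    using seq_imp_weak_sequencing[OF ys(1)] assms(7) unfolding ys(2) by blast
  moreover have "alternating_parity ys"
    using ys assms(7) even_iff unfolding alternating_parity_def seq_def successively_conv_nth
    by (metis Suc_lessD nth_mem subsetD)
  ultimately show ?thesis by blast
qed

end
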